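(* Let $\alpha\ge0$. On the extremal Reissner-Nordström background (horizon at $r=1$) let $\rho\in(-\infty,\infty)$ be the coordinate defined for $r\in(1,\infty)$ by $d\rho=\frac{r^2}{(r-1)^2}\,dr$, and consider the Schrödinger equation $$-\frac{d^2w}{d\rho^2}+V w=\omega^2w,\qquad V=\Bigl(1-\frac1r\Bigr)^2\Bigl(\alpha^2-\frac1{r^2}\Bigr),$$ on $L^2(\mathbb R,d\rho)$, which governs the linear perturbations $e^{i\omega t}w$ of the Yang-Mills amplitude $W$ about the background value $W\equiv0$. (a) If $\alpha<\sqrt3/2$, there are infinitely many bound states with $\omega^2<0$, with eigenvalues accumulating at $\omega^2=0$; that is, the extremal Reissner-Nordström black hole has infinitely many unstable modes of this type. (b) If $\alpha\ge\sqrt3/2$, there are no bound states with $\omega^2<0$; that is, the extremal Reissner-Nordström black hole is stable against these perturbations. In particular, the extremal Reissner-Nordström black hole changes stability exactly at $\alpha=\sqrt3/2$ (independently of the Higgs mass).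
   Context: The setting is the static, spherically symmetric $SU(2)$ Einstein-Yang-Mills-Higgs theory with Higgs triplet. The dimensionless parameter $\alpha$ is the Yang-Mills mass (the Higgs vacuum value) in suitable units, and $W$ is the amplitude of the magnetic Yang-Mills ansatz. The extremal Reissner-Nordström black hole is the solution with $W\equiv0$, Higgs amplitude $H\equiv\alpha$, horizon radius $r_h=1$ and metric function $e^{\nu}=1-1/r$ (square root of the $dt^2$ coefficient). In the linearization about this solution, the metric perturbations vanish and the Higgs field contributes no unstable modes. The stability problem therefore reduces to the equation for the perturbation $W=e^{i\omega t}w$, which takes the form of the Schrödinger equation in the claim. An unstable mode is an $L^2$ solution with $\omega^2<0$. The coordinate $\rho$ tends to $-\infty$ as $r\to1$ and to $+\infty$ as $r\to\infty$; its additive constant is irrelevant. *)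

theory Defs
  imports "HOL-Analysis.Analysis" "HOL-Real_Asymp.Real_Asymp"
begin

text \<open>The defining equation of \<open>\<rho>\<close> fixes it on \<open>(1,\<infinity>)\<close> up to an additive constant; its values at
  \<open>r \<le> 1\<close> are irrelevant.\<close>

definition rho_coordinate :: "(real \<Rightarrow> real) \<Rightarrow> bool" where
  "rho_coordinate \<rho> \<longleftrightarrow> (\<forall>r>1. (\<rho> has_real_derivative r\<^sup>2 / (r - 1)\<^sup>2) (at r))"

definition radius :: "(real \<Rightarrow> real) \<Rightarrow> real \<Rightarrow> real" where
  "radius \<rho> = inv_into {1<..} \<rho>"

definition V :: "real \<Rightarrow> (real \<Rightarrow> real) \<Rightarrow> real \<Rightarrow> real" where
  "V \<alpha> \<rho> x = (let r = radius \<rho> x in (1 - 1 / r)\<^sup>2 * (\<alpha>\<^sup>2 - 1 / r\<^sup>2))"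

text \<open>The number \<open>E\<close> plays the role of \<open>\<omega>\<^sup>2\<close>. The potentials of interest are continuous, so that
  solutions of the equation are classical.\<close>

definition bound_state :: "(real \<Rightarrow> real) \<Rightarrow> real \<Rightarrow> (real \<Rightarrow> complex) \<Rightarrow> bool" where
  "bound_state U E w \<longleftrightarrow>
     (\<exists>x. w x \<noteq> 0) \<and>
     integrable lborel (\<lambda>x. (norm (w x))\<^sup>2) \<and>
     (\<exists>w' w''. \<forall>x. (w has_vector_derivative w' x) (at x) \<and>
                   (w' has_vector_derivative w'' x) (at x) \<and>
                   - w'' x + of_real (U x) * w x = of_real E * w x)"

definition unstable_eigenvalues :: "real \<Rightarrow> (real \<Rightarrow> real) \<Rightarrow> real set" where
  "unstable_eigenvalues \<alpha> \<rho> = {E. E < 0 \<and> (\<exists>w. bound_state (V \<alpha> \<rho>) E w)}"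

definition stable :: "real \<Rightarrow> (real \<Rightarrow> real) \<Rightarrow> bool" where
  "stable \<alpha> \<rho> \<longleftrightarrow> \<not> (\<exists>E w. E < 0 \<and> bound_state (V \<alpha> \<rho>) E w)"

lemma rho_coordinate_explicit:
  "rho_coordinate (\<lambda>r. r + 2 * ln (r - 1) - 1 / (r - 1) + c)"
  unfolding rho_coordinate_def
proof (intro allI impI)
  fix r :: real assume "r > 1"
  then have "1 + 2 / (r - 1) + 1 / (r - 1)\<^sup>2 = r\<^sup>2 / (r - 1)\<^sup>2"
    by (simp add: divide_simps power2_eq_square) (simp add: algebra_simps)
  with \<open>r > 1\<close> show
      "((\<lambda>r. r + 2 * ln (r - 1) - 1 / (r - 1) + c) has_real_derivative r\<^sup>2 / (r - 1)\<^sup>2) (at r)"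
    by (auto intro!: derivative_eq_intros simp: power2_eq_square)
qed

lemma rho_coordinate_unique:
  assumes "rho_coordinate \<rho>" "rho_coordinate \<sigma>"
  obtains c where "\<And>r. r > 1 \<Longrightarrow> \<rho> r = \<sigma> r + c"
proof -
  have "\<exists>c. \<forall>r\<in>{1<..}. \<rho> r - \<sigma> r = c"
  proof (rule has_field_derivative_zero_constant)
    show "((\<lambda>r. \<rho> r - \<sigma> r) has_field_derivative 0) (at r within {1<..})" if "r \<in> {1<..}" for r
      using DERIV_diff[OF assms[unfolded rho_coordinate_def, rule_format]] that
      by (auto intro: has_field_derivative_at_within)
  qed auto
  then obtain c where "\<And>r. r > 1 \<Longrightarrow> \<rho> r - \<sigma> r = c"
    by auto
  then show ?thesis
    using that[of c] by (simp add: algebra_simps)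
qed

text \<open>Hence \<^const>\<open>radius\<close> is a genuine two-sided inverse, defined on all of \<open>\<real>\<close>.\<close>

lemma rho_coordinate_bij:
  assumes "rho_coordinate \<rho>"
  shows "bij_betw \<rho> {1<..} UNIV"
proof -
  have pos: "\<rho> a < \<rho> b" if "1 < a" "a < b" for a b
  proof (rule DERIV_pos_imp_increasing[OF that(2)])
    fix r assume "a \<le> r"
    then have "r > 1" using that by simp
    then show "\<exists>d. (\<rho> has_real_derivative d) (at r) \<and> 0 < d"
      using assms by (intro exI[of _ "r\<^sup>2 / (r - 1)\<^sup>2"]) (simp add: rho_coordinate_def)
  qed
  then have "inj_on \<rho> {1<..}"
    by (intro linorder_inj_onI') (metis greaterThan_iff less_irrefl)
  moreover have "y \<in> \<rho> ` {1<..}" for y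
  proof -
    define \<sigma> where "\<sigma> = (\<lambda>r::real. r + 2 * ln (r - 1) - 1 / (r - 1) + 0)"
    obtain c where c: "\<And>r. r > 1 \<Longrightarrow> \<rho> r = \<sigma> r + c"
      using rho_coordinate_unique[OF assms rho_coordinate_explicit[of 0]] unfolding \<sigma>_def by blast
    have "filterlim \<sigma> at_bot (at_right 1)" "filterlim \<sigma> at_top at_top"
      unfolding \<sigma>_def by real_asymp+
    then have "eventually (\<lambda>r. \<sigma> r \<le> y - c) (at_right 1)" "eventually (\<lambda>r. \<sigma> r \<ge> y - c) at_top"
      by (auto simp: filterlim_at_bot filterlim_at_top)
    then have "eventually (\<lambda>r. \<sigma> r \<le> y - c \<and> 1 < r) (at_right 1)"
              "eventually (\<lambda>r. \<sigma> r \<ge> y - c \<and> 1 < r) at_top"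
      by (auto intro!: eventually_conj eventually_gt_at_top eventually_at_right_less)
    then obtain a b where ab: "1 < a" "\<sigma> a \<le> y - c" "1 < b" "\<sigma> b \<ge> y - c"
      using eventually_happens'[OF trivial_limit_at_right_real]
            eventually_happens'[OF trivial_limit_at_top_linorder] by blast
    then have le: "\<rho> a \<le> y" "y \<le> \<rho> b"
      using c[of a] c[of b] by auto
    then have "a \<le> b"
      using pos[of b a] ab by force
    moreover have "continuous_on {a..b} \<rho>"
      using assms ab unfolding rho_coordinate_def
      by (meson DERIV_isCont atLeastAtMost_iff continuous_at_imp_continuous_on less_le_trans)
    ultimately obtain x where "a \<le> x" "x \<le> b" "\<rho> x = y"
      using IVT'[of \<rho> a y b] le by blast
    then show ?thesis using ab by force
  qed
  ultimately show ?thesis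
    by (auto simp: bij_betw_def)
qed

end

theory Submission
  imports Defs
begin

text \<open>Near the horizon \<open>V\<close> behaves like \<open>(\<alpha>\<^sup>2 - 1) / \<rho>\<^sup>2\<close>, and an inverse-square potential binds infinitely
  many states iff its strength is below \<open>- 1 / 4\<close>, that is iff \<open>\<alpha>\<^sup>2 < 3 / 4\<close>.

  For \<open>\<alpha>\<^sup>2 \<ge> 3 / 4\<close> the function \<open>g = - (1 - 1 / r) / 2\<close> satisfies \<open>g' + g\<^sup>2 \<le> V\<close>, so that \<open>- d\<^sup>2/d\<rho>\<^sup>2 + V\<close>
  dominates \<open>(d/d\<rho> + g) (- d/d\<rho> + g) \<ge> 0\<close>.

  For \<open>\<alpha>\<^sup>2 < 3 / 4\<close>, solve the Dirichlet problem on \<open>[-n, n]\<close> by shooting with the Prufer angle \<open>\<theta>\<close>. At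
  energy \<open>- \<epsilon>\<close> the angle at \<open>n\<close> is bounded by some \<open>K \<pi>\<close> uniformly in \<open>n\<close>, while at a smaller energy \<open>- \<delta>\<close>
  Sturm comparison on the horizon side makes it exceed \<open>K \<pi>\<close> for all large \<open>n\<close>. Hence there are Dirichlet
  eigenvalues in \<open>[- \<epsilon>, - \<delta>]\<close> for all large \<open>n\<close>, and a subsequence of the angles converges to that of a
  bound state. So every interval \<open>[- \<epsilon>, 0)\<close> contains an eigenvalue.\<close>

section \<open>Ordinary differential equations on the line\<close>

lemma deriv_nonneg_mono:
  fixes f f' :: "real \<Rightarrow> real"
  assumes "a \<le> b"
    and "\<And>x. a \<le> x \<Longrightarrow> x \<le> b \<Longrightarrow> (f has_real_derivative f' x) (at x)"
    and "\<And>x. a \<le> x \<Longrightarrow> x \<le> b \<Longrightarrow> 0 \<le> f' x"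
  shows "f a \<le> f b"
  by (rule DERIV_nonneg_imp_nondecreasing[OF assms(1)]) (use assms(2,3) in metis)

lemma continuous_antiderivative:
  fixes g :: "real \<Rightarrow> real"
  assumes "continuous_on UNIV g"
  obtains G where "G a = c" "\<And>x. (G has_real_derivative g x) (at x)"
proof -
  have "\<exists>F. \<forall>x. (F has_vector_derivative g x) (at x)"
    using einterval_antiderivative[of "-\<infinity>" "\<infinity>" g] assms
    by (auto simp: continuous_on_eq_continuous_at)
  then obtain F where F: "\<And>x. (F has_real_derivative g x) (at x)"
    by (auto simp: has_real_derivative_iff_has_vector_derivative)
  show ?thesis
    by (rule that[of "\<lambda>x. F x - F a + c"]) (auto intro!: derivative_eq_intros F)
qed

text \<open>Integrating \<open>exp (k * \<bar>x\<bar>)\<close> from 0 costs only a factor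
  \<open>1 / k\<close> in the weighted norm; this factor is what makes the Picard map
  contract.\<close>

lemma antiderivative_exp_bound:
  fixes G g :: "real \<Rightarrow> real"
  assumes G: "\<And>x. (G has_real_derivative g x) (at x)" "G 0 = 0"
    and g: "\<And>x. \<bar>g x\<bar> \<le> D * exp (k * \<bar>x\<bar>)" and "k > 0"
  shows "\<bar>G x\<bar> \<le> D / k * exp (k * \<bar>x\<bar>)"
proof -
  have "D \<ge> 0" using g[of 0] by simp
  \<comment> \<open>Stated for arbitrary \<open>H\<close> so that it covers \<open>G\<close>,
    \<open>- G\<close> and their reflections in 0.\<close>
  have one: "H x \<le> D / k * exp (k * x)"
    if "x \<ge> 0" "H 0 = 0" and H: "\<And>y. (H has_real_derivative h y) (at y)"
      and h: "\<And>y. \<bar>h y\<bar> \<le> D * exp (k * \<bar>y\<bar>)" for H h :: "real \<Rightarrow> real" and x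
  proof -
    have "D / k * exp (k * 0) - H 0 \<le> D / k * exp (k * x) - H x"
    proof (rule deriv_nonneg_mono[OF \<open>x \<ge> 0\<close>])
      fix y :: real assume "0 \<le> y"
      show "((\<lambda>y. D / k * exp (k * y) - H y) has_real_derivative D * exp (k * y) - h y) (at y)"
        using \<open>k > 0\<close> by (auto intro!: derivative_eq_intros H)
      show "0 \<le> D * exp (k * y) - h y"
        using h[of y] \<open>0 \<le> y\<close> by simp
    qed
    moreover have "0 \<le> D / k" using \<open>D \<ge> 0\<close> \<open>k > 0\<close> by simp
    ultimately show ?thesis using \<open>H 0 = 0\<close> by simp
  qed
  have m: "((\<lambda>y. G (- y)) has_real_derivative - g (- y)) (at y)" for y
    using DERIV_mirror[of G "g (-y)" y] G(1)[of "-y"] by (auto simp: DERIV_mirror)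
  have "G x \<le> D / k * exp (k * x)" "- G x \<le> D / k * exp (k * x)" if "x \<ge> 0"
    using one[OF that, of G g] one[OF that, of "\<lambda>x. - G x" "\<lambda>x. - g x"] G g
    by (auto intro!: derivative_eq_intros)
  moreover have "G x \<le> D / k * exp (k * (-x))" "- G x \<le> D / k * exp (k * (-x))" if "x \<le> 0"
    using one[of "-x" "\<lambda>y. G (- y)" "\<lambda>y. - g (- y)"] one[of "-x" "\<lambda>y. - G (- y)" "\<lambda>y. g (- y)"]
      that G(2) g[of "-y" for y] m DERIV_minus[OF m]
    by auto
  ultimately show ?thesis
    by (cases "x \<ge> 0") auto
qed

text \<open>Picard iteration in the norm weighted by \<open>exp (-k \<bar>x - a\<bar>)\<close>, where \<open>k > 2 L\<close> makes it a
  contraction on the whole line at once.\<close>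

lemma lipschitz_ode_solution:
  fixes f :: "real \<Rightarrow> real \<Rightarrow> real"
  assumes cont: "continuous_on UNIV (\<lambda>(x, t). f x t)"
    and lip: "\<And>x s t. \<bar>f x s - f x t\<bar> \<le> L * \<bar>s - t\<bar>"
    and bdd: "\<And>x t. \<bar>f x t\<bar> \<le> D"
  obtains y where "y a = t0" "\<And>x. (y has_real_derivative f x (y x)) (at x)"
proof -
  have "0 \<le> L" using lip[of 0 1 0] by simp
  define k where "k = 2 * L + 1"
  have k: "k > 0" "L / k \<le> 1 / 2" using \<open>0 \<le> L\<close> by (auto simp: k_def field_simps)
  \<comment> \<open>The unknown \<open>\<psi>\<close> is the solution recentred at \<open>a\<close>
    and divided by the weight, which makes it bounded.\<close>
  define g where "g = (\<lambda>(\<psi> :: real \<Rightarrow>\<^sub>C real) x. f (x + a) (exp (k * \<bar>x\<bar>) * apply_bcontfun \<psi> x))"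
  have "continuous_on UNIV (g \<psi>)" for \<psi>
  proof -
    have "continuous_on UNIV ((\<lambda>(x, t). f x t) \<circ> (\<lambda>x. (x + a, exp (k * \<bar>x\<bar>) * apply_bcontfun \<psi> x)))"
      by (intro continuous_on_compose continuous_intros continuous_on_subset[OF cont]) auto
    then show ?thesis by (simp add: g_def o_def)
  qed
  then have "\<forall>\<psi>. \<exists>J. J 0 = 0 \<and> (\<forall>x. (J has_real_derivative g \<psi> x) (at x))"
    by (metis continuous_antiderivative)
  then obtain J where J: "\<And>\<psi>. J \<psi> 0 = 0" "\<And>\<psi> x. (J \<psi> has_real_derivative g \<psi> x) (at x)"
    by metis
  have "D \<ge> 0" using bdd[of 0 0] by simp
  have J_bound: "exp (- k * \<bar>x\<bar>) * \<bar>J \<psi> x\<bar> \<le> D / k" for \<psi> x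
  proof -
    have "\<bar>g \<psi> y\<bar> \<le> D * exp (k * \<bar>y\<bar>)" for y
    proof -
      have "\<bar>g \<psi> y\<bar> \<le> D * 1" using bdd by (simp add: g_def)
      also have "\<dots> \<le> D * exp (k * \<bar>y\<bar>)"
        using k \<open>D \<ge> 0\<close> by (intro mult_left_mono) auto
      finally show ?thesis .
    qed
    from antiderivative_exp_bound[OF J(2,1) this k(1)] show ?thesis
      by (simp add: exp_minus field_simps)
  qed
  \<comment> \<open>\<open>Bcontfun\<close> is meaningful only on bounded continuous functions, so
    membership is checked before the values of \<open>T\<close> are read off.\<close>
  define T where "T = (\<lambda>\<psi>. Bcontfun (\<lambda>x. exp (- k * \<bar>x\<bar>) * (t0 + J \<psi> x)))"
  have T: "apply_bcontfun (T \<psi>) x = exp (- k * \<bar>x\<bar>) * (t0 + J \<psi> x)" for \<psi> x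
  proof -
    have "continuous_on UNIV (J \<psi>)"
      using J(2) by (meson DERIV_isCont continuous_at_imp_continuous_on)
    moreover have "norm (exp (- k * \<bar>x\<bar>) * (t0 + J \<psi> x)) \<le> \<bar>t0\<bar> + D / k" for x
    proof -
      have "norm (exp (- k * \<bar>x\<bar>) * (t0 + J \<psi> x)) \<le> exp (- k * \<bar>x\<bar>) * \<bar>t0\<bar> + exp (- k * \<bar>x\<bar>) * \<bar>J \<psi> x\<bar>"
        by (simp add: abs_mult flip: distrib_left)
      also have "exp (- k * \<bar>x\<bar>) * \<bar>t0\<bar> \<le> 1 * \<bar>t0\<bar>"
        using k by (intro mult_right_mono) auto
      finally show ?thesis using J_bound[of x \<psi>] by simp
    qed
    ultimately have "(\<lambda>x. exp (- k * \<bar>x\<bar>) * (t0 + J \<psi> x)) \<in> bcontfun"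
      by (intro bcontfun_normI continuous_intros) auto
    then show ?thesis by (simp add: T_def Bcontfun_inverse)
  qed
  have "dist (T \<phi>) (T \<psi>) \<le> 1 / 2 * dist \<phi> \<psi>" for \<phi> \<psi>
  proof (rule dist_bound)
    fix x
    have "\<bar>g \<phi> y - g \<psi> y\<bar> \<le> (L * dist \<phi> \<psi>) * exp (k * \<bar>y\<bar>)" for y
    proof -
      have "\<bar>g \<phi> y - g \<psi> y\<bar> \<le> L * (exp (k * \<bar>y\<bar>) * \<bar>apply_bcontfun \<phi> y - apply_bcontfun \<psi> y\<bar>)"
        using lip[of "y + a" "exp (k * \<bar>y\<bar>) * apply_bcontfun \<phi> y" "exp (k * \<bar>y\<bar>) * apply_bcontfun \<psi> y"]
        by (simp add: g_def abs_mult flip: right_diff_distrib)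
      also have "\<dots> \<le> L * (exp (k * \<bar>y\<bar>) * dist \<phi> \<psi>)"
        using \<open>0 \<le> L\<close> dist_bounded[of \<phi> y \<psi>] by (intro mult_left_mono) (auto simp: dist_real_def)
      finally show ?thesis by (simp add: mult_ac)
    qed
    moreover have "((\<lambda>x. J \<phi> x - J \<psi> x) has_real_derivative g \<phi> x - g \<psi> x) (at x)" for x
      by (intro DERIV_diff J)
    ultimately have "\<bar>J \<phi> x - J \<psi> x\<bar> \<le> (L * dist \<phi> \<psi>) / k * exp (k * \<bar>x\<bar>)"
      using antiderivative_exp_bound[of "\<lambda>x. J \<phi> x - J \<psi> x" "\<lambda>x. g \<phi> x - g \<psi> x"] J(1) k(1) by simp
    then have "exp (- k * \<bar>x\<bar>) * \<bar>J \<phi> x - J \<psi> x\<bar> \<le> L / k * dist \<phi> \<psi>"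
      by (simp add: exp_minus field_simps)
    moreover have "dist (apply_bcontfun (T \<phi>) x) (apply_bcontfun (T \<psi>) x)
        = exp (- k * \<bar>x\<bar>) * \<bar>J \<phi> x - J \<psi> x\<bar>"
      unfolding T dist_real_def by (simp add: abs_mult flip: right_diff_distrib)
    ultimately have "dist (apply_bcontfun (T \<phi>) x) (apply_bcontfun (T \<psi>) x) \<le> L / k * dist \<phi> \<psi>"
      by simp
    also have "\<dots> \<le> 1 / 2 * dist \<phi> \<psi>"
      using k(2) by (intro mult_right_mono) auto
    finally show "dist (apply_bcontfun (T \<phi>) x) (apply_bcontfun (T \<psi>) x) \<le> 1 / 2 * dist \<phi> \<psi>" .
  qed
  then have "\<exists>!\<psi>. T \<psi> = \<psi>"
    by (intro banach_fix_type[of "1/2"]) auto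
  then obtain \<psi> where "T \<psi> = \<psi>" by blast
  then have fixed: "exp (k * \<bar>x\<bar>) * apply_bcontfun \<psi> x = t0 + J \<psi> x" for x
    using T[of \<psi> x] by (simp add: exp_minus)
  show ?thesis
  proof (rule that[of "\<lambda>x. t0 + J \<psi> (x - a)"])
    fix x
    have "((\<lambda>x. t0 + J \<psi> (x - a)) has_real_derivative g \<psi> (x - a)) (at x)"
      by (auto intro!: derivative_eq_intros DERIV_chain2[OF J(2)])
    then show "((\<lambda>x. t0 + J \<psi> (x - a)) has_real_derivative f x (t0 + J \<psi> (x - a))) (at x)"
      by (simp add: g_def fixed)
  qed (simp add: J)
qed

text \<open>At a first return to \<open>c\<close> the derivative would be positive, so
  \<open>y\<close> would lie below \<open>c\<close> just before and would have met \<open>c\<close>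
  even earlier.\<close>

lemma barrier_upward:
  fixes y y' :: "real \<Rightarrow> real"
  assumes y: "\<And>x. (y has_real_derivative y' x) (at x)"
    and up: "\<And>x. a \<le> x \<Longrightarrow> x \<le> b \<Longrightarrow> y x = c \<Longrightarrow> y' x > 0"
    and "y a \<ge> c" "a < b"
  shows "y b > c"
proof (rule ccontr)
  assume "\<not> y b > c"
  have cont: "continuous_on S y" for S
    using y by (meson DERIV_isCont continuous_at_imp_continuous_on)
  have "\<exists>a'. a \<le> a' \<and> a' < b \<and> y a' > c"
  proof (cases "y a = c")
    case True
    then obtain d where d: "d > 0" "\<And>h. h > 0 \<Longrightarrow> h < d \<Longrightarrow> y a < y (a + h)"
      using DERIV_pos_inc_right[OF y up, of a] \<open>a < b\<close> by auto
    define h where "h = min d (b - a) / 2"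
    have "0 < h" "h < d" "a + h < b"
      using d(1) \<open>a < b\<close> by (auto simp: h_def min_def field_simps)
    then show ?thesis
      using d(2)[of h] True by (intro exI[of _ "a + h"]) auto
  next
    case False
    then show ?thesis using \<open>y a \<ge> c\<close> \<open>a < b\<close> by (intro exI[of _ a]) auto
  qed
  then obtain a' where a': "a \<le> a'" "a' < b" "y a' > c" by blast
  define S where "S = {x \<in> {a'..b}. y x = c}"
  have S: "compact S"
  proof -
    have "closed S" unfolding S_def
      using continuous_closed_preimage_constant[OF cont[of "{a'..b}"], of c] by simp
    moreover have "bounded S" by (rule bounded_subset[of "{a'..b}"]) (auto simp: S_def)
    ultimately show ?thesis by (simp add: compact_eq_bounded_closed)
  qed
  obtain x0 where "a' \<le> x0" "x0 \<le> b" "y x0 = c"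
    using IVT2'[of y b c a'] cont[of "{a'..b}"] a' \<open>\<not> y b > c\<close> by (meson less_imp_le not_less)
  then have "S \<noteq> {}" by (auto simp: S_def)
  with S obtain m where m: "m \<in> S" "\<And>x. x \<in> S \<Longrightarrow> m \<le> x"
    using compact_attains_inf[of S] by blast
  have "m > a'" using m(1) a'(3) by (cases "m = a'") (simp_all add: S_def)
  have "y' m > 0"
    using up[of m] m(1) a'(1) by (simp add: S_def)
  then obtain d where d: "d > 0" "\<And>h. h > 0 \<Longrightarrow> h < d \<Longrightarrow> y (m - h) < y m"
    using DERIV_pos_inc_left[OF y \<open>y' m > 0\<close>] by blast
  define h where "h = min d (m - a') / 2"
  have h: "0 < h" "h < d" "a' \<le> m - h"
    using d(1) \<open>m > a'\<close> by (auto simp: h_def min_def field_simps)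
  then have "y (m - h) \<le> c"
    using d(2)[of h] m(1) by (simp add: S_def)
  then obtain x where x: "a' \<le> x" "x \<le> m - h" "y x = c"
    using IVT2'[of y "m - h" c a'] cont[of "{a'..m - h}"] a'(3) h(3) by (meson less_imp_le)
  then have "x \<in> S"
    using m(1) h by (simp add: S_def)
  then show False
    using m(2)[of x] x h by simp
qed

section \<open>The Prufer angle\<close>

text \<open>Prufer angle equation: \<open>w = R sin \<theta>\<close>, \<open>w' = R cos \<theta>\<close> for a solution of \<open>- w'' + U w = E w\<close>.\<close>

definition prufer :: "(real \<Rightarrow> real) \<Rightarrow> real \<Rightarrow> (real \<Rightarrow> real) \<Rightarrow> bool" where
  "prufer U E \<theta> \<longleftrightarrow>
     (\<forall>x. (\<theta> has_real_derivative (cos (\<theta> x))\<^sup>2 + (E - U x) * (sin (\<theta> x))\<^sup>2) (at x))"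

lemma pruferD:
  "prufer U E \<theta> \<Longrightarrow> (\<theta> has_real_derivative (cos (\<theta> x))\<^sup>2 + (E - U x) * (sin (\<theta> x))\<^sup>2) (at x)"
  by (simp add: prufer_def)

lemma prufer_continuous_on: "prufer U E \<theta> \<Longrightarrow> continuous_on S \<theta>"
  by (meson DERIV_isCont continuous_at_imp_continuous_on pruferD)

lemma prufer_rhs_lipschitz:
  fixes e s t :: real
  assumes "\<bar>e\<bar> \<le> D"
  shows "\<bar>((cos s)\<^sup>2 + e * (sin s)\<^sup>2) - ((cos t)\<^sup>2 + e * (sin t)\<^sup>2)\<bar> \<le> (2 + 2 * D) * \<bar>s - t\<bar>"
proof -
  have "(sin s)\<^sup>2 - (sin t)\<^sup>2 = (sin s + sin t) * (sin s - sin t)"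
    by (simp add: power2_eq_square algebra_simps)
  also have "\<bar>\<dots>\<bar> \<le> 2 * \<bar>s - t\<bar>"
  proof -
    have "\<bar>sin s + sin t\<bar> \<le> 2"
      using abs_triangle_ineq[of "sin s" "sin t"] abs_sin_le_one[of s] abs_sin_le_one[of t] by linarith
    moreover have "\<bar>sin s - sin t\<bar> \<le> \<bar>s - t\<bar>"
    proof -
      have "norm (sin s - sin t) \<le> 1 * norm (s - t)"
        by (rule field_differentiable_bound[of UNIV sin cos])
           (auto intro: DERIV_sin has_field_derivative_at_within)
      then show ?thesis by simp
    qed
    ultimately show ?thesis
      unfolding abs_mult by (intro mult_mono) auto
  qed
  finally have *: "\<bar>(sin s)\<^sup>2 - (sin t)\<^sup>2\<bar> \<le> 2 * \<bar>s - t\<bar>" .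
  have "((cos s)\<^sup>2 + e * (sin s)\<^sup>2) - ((cos t)\<^sup>2 + e * (sin t)\<^sup>2) = (e - 1) * ((sin s)\<^sup>2 - (sin t)\<^sup>2)"
    by (simp add: cos_squared_eq algebra_simps)
  also have "\<bar>\<dots>\<bar> \<le> (1 + D) * (2 * \<bar>s - t\<bar>)"
    unfolding abs_mult using * assms by (intro mult_mono) auto
  finally show ?thesis by (simp add: algebra_simps)
qed

lemma prufer_rhs_bound:
  fixes e t :: real
  assumes "\<bar>e\<bar> \<le> D"
  shows "\<bar>(cos t)\<^sup>2 + e * (sin t)\<^sup>2\<bar> \<le> 1 + D"
proof -
  have "\<bar>e * (sin t)\<^sup>2\<bar> \<le> D * 1"
    unfolding abs_mult using assms abs_square_le_1[of "sin t"] by (intro mult_mono) auto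
  moreover have "0 \<le> (cos t)\<^sup>2" "(cos t)\<^sup>2 \<le> 1"
    by (simp_all add: abs_square_le_1)
  ultimately show ?thesis
    by linarith
qed

lemma prufer_exists:
  assumes "continuous_on UNIV U" "\<And>x. \<bar>U x\<bar> \<le> B"
  obtains \<theta> where "prufer U E \<theta>" "\<theta> a = t0"
proof -
  have b: "\<bar>E - U x\<bar> \<le> \<bar>E\<bar> + B" for x
    using assms(2)[of x] by linarith
  have "continuous_on UNIV (\<lambda>(x, t). (cos t)\<^sup>2 + (E - U x) * (sin t)\<^sup>2)"
    unfolding case_prod_beta
    by (intro continuous_intros continuous_on_compose2[OF assms(1)]) auto
  from lipschitz_ode_solution[OF this prufer_rhs_lipschitz[OF b] prufer_rhs_bound[OF b], of a t0] that
  show ?thesis unfolding prufer_def by metis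
qed

text \<open>Gronwall's inequality for \<open>h = (\<theta>\<^sub>1 - \<theta>\<^sub>2)\<^sup>2 + (E\<^sub>1 - E\<^sub>2)\<^sup>2\<close>, which satisfies \<open>\<bar>h'\<bar> \<le> C h\<close>.\<close>

lemma prufer_dist:
  assumes "prufer U E1 \<theta>1" "prufer U E2 \<theta>2" and B: "\<And>x. \<bar>U x\<bar> \<le> B"
  defines "C \<equiv> 5 + 4 * (\<bar>E1\<bar> + B)"
  shows "(\<theta>1 x - \<theta>2 x)\<^sup>2 + (E1 - E2)\<^sup>2
           \<le> ((\<theta>1 a - \<theta>2 a)\<^sup>2 + (E1 - E2)\<^sup>2) * exp (C * \<bar>x - a\<bar>)"
proof -
  define h where "h = (\<lambda>x. (\<theta>1 x - \<theta>2 x)\<^sup>2 + (E1 - E2)\<^sup>2)"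
  define h' where "h' = (\<lambda>x. 2 * (\<theta>1 x - \<theta>2 x) *
    (((cos (\<theta>1 x))\<^sup>2 + (E1 - U x) * (sin (\<theta>1 x))\<^sup>2) - ((cos (\<theta>2 x))\<^sup>2 + (E2 - U x) * (sin (\<theta>2 x))\<^sup>2)))"
  have h: "(h has_real_derivative h' x) (at x)" for x
    unfolding h_def h'_def using assms(1,2)
    by (auto intro!: derivative_eq_intros pruferD)
  have bound: "\<bar>h' x\<bar> \<le> C * h x" for x
  proof -
    define d where "d = \<bar>\<theta>1 x - \<theta>2 x\<bar>"
    define e where "e = \<bar>E1 - E2\<bar>"
    have "\<bar>E1 - U x\<bar> \<le> \<bar>E1\<bar> + B" using B[of x] by linarith
    note lip = prufer_rhs_lipschitz[OF this, of "\<theta>1 x" "\<theta>2 x"]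
    have "\<bar>(E1 - E2) * (sin (\<theta>2 x))\<^sup>2\<bar> \<le> e * 1"
      unfolding abs_mult e_def using abs_square_le_1[of "sin (\<theta>2 x)"] by (intro mult_mono) auto
    moreover have "((cos (\<theta>1 x))\<^sup>2 + (E1 - U x) * (sin (\<theta>1 x))\<^sup>2) - ((cos (\<theta>2 x))\<^sup>2 + (E2 - U x) * (sin (\<theta>2 x))\<^sup>2)
      = ((cos (\<theta>1 x))\<^sup>2 + (E1 - U x) * (sin (\<theta>1 x))\<^sup>2) - ((cos (\<theta>2 x))\<^sup>2 + (E1 - U x) * (sin (\<theta>2 x))\<^sup>2)
        + (E1 - E2) * (sin (\<theta>2 x))\<^sup>2"
      by (simp add: algebra_simps)
    ultimately have "\<bar>((cos (\<theta>1 x))\<^sup>2 + (E1 - U x) * (sin (\<theta>1 x))\<^sup>2) - ((cos (\<theta>2 x))\<^sup>2 + (E2 - U x) * (sin (\<theta>2 x))\<^sup>2)\<bar>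
      \<le> (2 + 2 * (\<bar>E1\<bar> + B)) * d + e"
      using lip unfolding d_def by linarith
    then have "\<bar>h' x\<bar> \<le> 2 * d * ((2 + 2 * (\<bar>E1\<bar> + B)) * d + e)"
      unfolding h'_def abs_mult by (intro mult_mono) (auto simp: d_def)
    also have "\<dots> = (4 + 4 * (\<bar>E1\<bar> + B)) * d\<^sup>2 + 2 * d * e"
      by (simp add: power2_eq_square algebra_simps)
    also have "2 * d * e \<le> d\<^sup>2 + e\<^sup>2"
      using sum_squares_bound[of d e] by simp
    also have "(4 + 4 * (\<bar>E1\<bar> + B)) * d\<^sup>2 + (d\<^sup>2 + e\<^sup>2) \<le> C * (d\<^sup>2 + e\<^sup>2)"
    proof -
      have "0 \<le> B" using B[of 0] by linarith
      then have "0 \<le> (4 + 4 * (\<bar>E1\<bar> + B)) * e\<^sup>2" by simp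
      then show ?thesis by (simp add: C_def algebra_simps)
    qed
    finally show ?thesis by (simp add: h_def d_def e_def)
  qed
  have "h x \<le> h a * exp (C * \<bar>x - a\<bar>)"
  proof (cases "a \<le> x")
    case True
    have "- (h a * exp (- C * a)) \<le> - (h x * exp (- C * x))"
    proof (rule deriv_nonneg_mono[OF True])
      fix y
      show "((\<lambda>y. - (h y * exp (- C * y))) has_real_derivative (C * h y - h' y) * exp (- C * y)) (at y)"
        by (auto intro!: derivative_eq_intros h simp: algebra_simps)
      show "0 \<le> (C * h y - h' y) * exp (- C * y)"
        using bound[of y] by (intro mult_nonneg_nonneg) auto
    qed
    then show ?thesis using True
      by (simp add: right_diff_distrib exp_diff exp_minus field_simps)
  next
    case False
    have "h x * exp (C * x) \<le> h a * exp (C * a)"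
    proof (rule deriv_nonneg_mono[of x a])
      fix y
      show "((\<lambda>y. h y * exp (C * y)) has_real_derivative (h' y + C * h y) * exp (C * y)) (at y)"
        by (auto intro!: derivative_eq_intros h simp: algebra_simps)
      show "0 \<le> (h' y + C * h y) * exp (C * y)"
        using bound[of y] by (intro mult_nonneg_nonneg) auto
    qed (use False in simp)
    then show ?thesis using False
      by (simp add: right_diff_distrib exp_diff exp_minus field_simps)
  qed
  then show ?thesis by (simp add: h_def)
qed

text \<open>The shift at most changes the sign of \<open>w\<close>. It reduces statements about
  crossing levels to the levels 0 and \<open>pi / 2\<close>.\<close>

lemma prufer_shift:
  fixes k :: int
  assumes "prufer U E \<theta>"
  shows "prufer U E (\<lambda>x. \<theta> x - of_int k * pi)"
proof -
  have "sin (of_int k * pi) = 0" "(cos (of_int k * pi))\<^sup>2 = 1"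
    by (auto simp: sin_zero_iff_int2 cos_squared_eq)
  then have "(cos (t - of_int k * pi))\<^sup>2 = (cos t)\<^sup>2" "(sin (t - of_int k * pi))\<^sup>2 = (sin t)\<^sup>2" for t
    by (simp_all add: cos_diff sin_diff power_mult_distrib)
  then show ?thesis
    unfolding prufer_def by (auto intro!: derivative_eq_intros pruferD[OF assms])
qed

text \<open>On a multiple of pi the sine vanishes and \<open>\<theta>' = 1\<close>. Zeros of
  \<open>w\<close> are thus passed only upward, and the angle counts them.\<close>

lemma prufer_crosses_upward:
  fixes k :: int
  assumes "prufer U E \<theta>" "\<theta> a \<ge> k * pi" "a < b"
  shows "\<theta> b > k * pi"
proof -
  have "\<theta> b - k * pi > 0"
  proof (rule barrier_upward[OF pruferD[OF prufer_shift[OF assms(1), of k]]])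
    fix x assume "\<theta> x - of_int k * pi = 0"
    then show "0 < (cos (\<theta> x - of_int k * pi))\<^sup>2 + (E - U x) * (sin (\<theta> x - of_int k * pi))\<^sup>2"
      by simp
  qed (use assms in auto)
  then show ?thesis by simp
qed

text \<open>On the level the cosine vanishes and \<open>\<theta>' = E - U < 0\<close>, so a
  classically forbidden interval blocks the angle from rising past it.\<close>

lemma prufer_forbidden_crossing:
  fixes k :: int
  assumes "prufer U E \<theta>" "\<theta> a \<le> k * pi + pi / 2" "a < b" "\<And>x. a \<le> x \<Longrightarrow> x \<le> b \<Longrightarrow> E < U x"
  shows "\<theta> b < k * pi + pi / 2"
proof -
  have "- (\<theta> b - k * pi) > - (pi / 2)"
  proof (rule barrier_upward[OF DERIV_minus[OF pruferD[OF prufer_shift[OF assms(1), of k]]]])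
    fix x assume *: "a \<le> x" "x \<le> b" "- (\<theta> x - of_int k * pi) = - (pi / 2)"
    then have "\<theta> x - of_int k * pi = pi / 2" by simp
    then show "0 < - ((cos (\<theta> x - of_int k * pi))\<^sup>2 + (E - U x) * (sin (\<theta> x - of_int k * pi))\<^sup>2)"
      using assms(4)[OF *(1,2)] by (simp only: cos_pi_half sin_pi_half) simp
  qed (use assms in auto)
  then show ?thesis by simp
qed

text \<open>The amplitude obeys \<open>R' = (1 + U - E) * sin \<theta> * cos \<theta> * R\<close>,
  solved by an exponential. This turns an angle back into a solution of the Schrodinger
  equation.\<close>

lemma prufer_amplitude:
  assumes "prufer U E \<theta>" "continuous_on UNIV U"
  obtains R where "\<And>x. R x > 0"
    "\<And>x. ((\<lambda>x. R x * sin (\<theta> x)) has_real_derivative R x * cos (\<theta> x)) (at x)"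
    "\<And>x. ((\<lambda>x. R x * cos (\<theta> x)) has_real_derivative (U x - E) * (R x * sin (\<theta> x))) (at x)"
proof -
  define q where "q = (\<lambda>x. (1 + U x - E) * (sin (\<theta> x) * cos (\<theta> x)))"
  have "continuous_on UNIV q"
    unfolding q_def by (intro continuous_intros prufer_continuous_on[OF assms(1)] assms(2))
  then obtain Q where Q: "\<And>x. (Q has_real_derivative q x) (at x)"
    using continuous_antiderivative by metis
  show ?thesis
  proof (rule that[of "\<lambda>x. exp (Q x)"])
    fix x
    define s c where "s = sin (\<theta> x)" and "c = cos (\<theta> x)"
    have sc: "c * c = 1 - s * s"
      using sin_cos_squared_add[of "\<theta> x"] by (simp add: s_def c_def power2_eq_square)
    have e1: "q x * s + c * (c\<^sup>2 + (E - U x) * s\<^sup>2) = c"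
    proof -
      have "q x * s + c * (c\<^sup>2 + (E - U x) * s\<^sup>2) = c * (s * s + c * c)"
        by (simp add: q_def s_def[symmetric] c_def[symmetric] power2_eq_square algebra_simps)
      then show ?thesis using sc by simp
    qed
    have e2: "q x * c - s * (c\<^sup>2 + (E - U x) * s\<^sup>2) = (U x - E) * s"
    proof -
      have "q x * c - s * (c\<^sup>2 + (E - U x) * s\<^sup>2) = (U x - E) * s * (s * s + c * c)"
        by (simp add: q_def s_def[symmetric] c_def[symmetric] power2_eq_square algebra_simps)
      then show ?thesis using sc by simp
    qed
    have "((\<lambda>x. exp (Q x) * sin (\<theta> x)) has_real_derivative
        exp (Q x) * (q x * s + c * (c\<^sup>2 + (E - U x) * s\<^sup>2))) (at x)"
      by (auto intro!: derivative_eq_intros Q pruferD[OF assms(1)] simp: s_def c_def algebra_simps)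
    then show "((\<lambda>x. exp (Q x) * sin (\<theta> x)) has_real_derivative exp (Q x) * cos (\<theta> x)) (at x)"
      unfolding e1 by (simp add: c_def)
    have "((\<lambda>x. exp (Q x) * cos (\<theta> x)) has_real_derivative
        exp (Q x) * (q x * c - s * (c\<^sup>2 + (E - U x) * s\<^sup>2))) (at x)"
      by (auto intro!: derivative_eq_intros Q pruferD[OF assms(1)] simp: s_def c_def algebra_simps)
    then show "((\<lambda>x. exp (Q x) * cos (\<theta> x)) has_real_derivative (U x - E) * (exp (Q x) * sin (\<theta> x))) (at x)"
      unfolding e2 by (simp add: s_def mult_ac)
  qed simp
qed

section \<open>Sturm comparison and the count of zeros\<close>

text \<open>Sturm comparison with a nonnegative arc \<open>v\<close>: otherwise \<open>w = R sin \<theta>\<close> would be nonnegative on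
  the arc, and the Wronskian \<open>w v' - v w'\<close> would increase from a nonnegative to a negative value.\<close>

lemma prufer_sturm_comparison_zero:
  assumes \<theta>: "prufer U E \<theta>" and "continuous_on UNIV U" and "a < b"
    and v: "\<And>x. a \<le> x \<Longrightarrow> x \<le> b \<Longrightarrow> (v has_real_derivative v' x) (at x)"
    and v': "\<And>x. a \<le> x \<Longrightarrow> x \<le> b \<Longrightarrow> (v' has_real_derivative p x * v x) (at x)"
    and "\<And>x. a \<le> x \<Longrightarrow> x \<le> b \<Longrightarrow> v x \<ge> 0"
    and "v a = 0" "v b = 0" "v' a \<ge> 0" "v' b < 0"
    and p: "\<And>x. a \<le> x \<Longrightarrow> x \<le> b \<Longrightarrow> U x - E \<le> p x"
    and "\<theta> a \<ge> 0"
  shows "\<theta> b \<ge> pi"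
proof (rule ccontr)
  assume "\<not> \<theta> b \<ge> pi"
  have pos: "\<theta> x > 0" if "x > a" for x
    using prufer_crosses_upward[OF \<theta>, of 0 a x] \<open>\<theta> a \<ge> 0\<close> that by simp
  have less: "\<theta> x < pi" if "x \<le> b" for x
    using prufer_crosses_upward[OF \<theta>, of 1 x b] \<open>\<not> \<theta> b \<ge> pi\<close> that by (cases "x = b") force+
  have nonneg: "\<theta> x \<ge> 0" if "x \<ge> a" for x
    using pos[of x] \<open>\<theta> a \<ge> 0\<close> that by (cases "x = a") auto
  obtain R where R: "\<And>x. R x > 0"
    "\<And>x. ((\<lambda>x. R x * sin (\<theta> x)) has_real_derivative R x * cos (\<theta> x)) (at x)"
    "\<And>x. ((\<lambda>x. R x * cos (\<theta> x)) has_real_derivative (U x - E) * (R x * sin (\<theta> x))) (at x)"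
    by (rule prufer_amplitude[OF \<theta> \<open>continuous_on UNIV U\<close>]) (rule that)
  define w where "w = (\<lambda>x. R x * sin (\<theta> x))"
  define w' where "w' = (\<lambda>x. R x * cos (\<theta> x))"
  have w: "(w has_real_derivative w' x) (at x)" "(w' has_real_derivative (U x - E) * w x) (at x)" for x
    using R(2,3)[of x] by (simp_all add: w_def w'_def)
  have w_nonneg: "w x \<ge> 0" if "a \<le> x" "x \<le> b" for x
    using nonneg[OF that(1)] less[OF that(2)] R(1)[of x] by (auto simp: w_def sin_ge_zero)
  have "w a * v' a - v a * w' a \<le> w b * v' b - v b * w' b"
  proof (rule deriv_nonneg_mono[of a b])
    fix x assume x: "a \<le> x" "x \<le> b"
    show "((\<lambda>x. w x * v' x - v x * w' x) has_real_derivative (p x - (U x - E)) * (v x * w x)) (at x)"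
      by (auto intro!: derivative_eq_intros w v[OF x] v'[OF x] simp: algebra_simps)
    show "0 \<le> (p x - (U x - E)) * (v x * w x)"
      using p[OF x] w_nonneg[OF x] assms(6)[OF x] by (intro mult_nonneg_nonneg) auto
  qed (use \<open>a < b\<close> in simp)
  moreover have "w a * v' a \<ge> 0"
    using w_nonneg[of a] \<open>a < b\<close> \<open>v' a \<ge> 0\<close> by simp
  moreover have "w b > 0"
    using pos[of b] less[of b] \<open>a < b\<close> R(1)[of b] by (auto simp: w_def intro!: mult_pos_pos sin_gt_zero)
  then have "w b * v' b < 0"
    using \<open>v' b < 0\<close> by (simp add: mult_pos_neg)
  ultimately show False
    using \<open>v a = 0\<close> \<open>v b = 0\<close> by simp
qed

text \<open>The comparison function is \<open>v x = sqrt (- x) sin (\<mu> ln (- x) - j \<pi>)\<close>, an Euler solution of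
  \<open>v'' = - (1 / 4 + \<mu>\<^sup>2) / x\<^sup>2 v\<close>.\<close>

lemma prufer_advance_inverse_square:
  fixes j :: nat and k :: int
  assumes \<theta>: "prufer U E \<theta>" and "continuous_on UNIV U" and "\<mu> > 0"
    and U: "\<And>x. - exp (Suc j * pi / \<mu>) \<le> x \<Longrightarrow> x \<le> - exp (j * pi / \<mu>) \<Longrightarrow>
               U x - E \<le> - (1 / 4 + \<mu>\<^sup>2) / x\<^sup>2"
    and "\<theta> (- exp (Suc j * pi / \<mu>)) \<ge> k * pi"
  shows "\<theta> (- exp (j * pi / \<mu>)) \<ge> (k + 1) * pi"
proof -
  \<comment> \<open>One half-wave of the sine: the phase \<open>\<phi>\<close> falls from pi at
    \<open>a\<close> to 0 at \<open>b\<close>.\<close>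
  define a b where "a = - exp (Suc j * pi / \<mu>)" and "b = - exp (j * pi / \<mu>)"
  define \<phi> where "\<phi> = (\<lambda>x. \<mu> * ln (- x) - j * pi)"
  define v where "v = (\<lambda>x. sqrt (- x) * sin (\<phi> x))"
  define v' where "v' = (\<lambda>x. - ((1 / 2) * sin (\<phi> x) + \<mu> * cos (\<phi> x)) / sqrt (- x))"
  have "a < b" "b < 0"
    using \<open>\<mu> > 0\<close> by (auto simp: a_def b_def divide_strict_right_mono)
  have \<phi>: "\<phi> a = pi" "\<phi> b = 0"
    using \<open>\<mu> > 0\<close> by (simp_all add: \<phi>_def a_def b_def field_simps)
  have der: "(v has_real_derivative v' x) (at x)"
    "(v' has_real_derivative (- (1 / 4 + \<mu>\<^sup>2) / x\<^sup>2) * v x) (at x)" if "x \<le> b" for x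
  proof -
    define s where "s = sqrt (- x)"
    have s: "s > 0" "x = - (s * s)"
      using that \<open>b < 0\<close> by (auto simp: s_def)
    have d\<phi>: "(\<phi> has_real_derivative - \<mu> / (s * s)) (at x)"
      unfolding \<phi>_def using s by (auto intro!: derivative_eq_intros)
    have ds: "((\<lambda>x. sqrt (- x)) has_real_derivative - 1 / (2 * s)) (at x)"
      using that \<open>b < 0\<close> by (auto intro!: derivative_eq_intros simp: s_def field_simps)
    have "(v has_real_derivative (- 1 / (2 * s)) * sin (\<phi> x) + (cos (\<phi> x) * (- \<mu> / (s * s))) * sqrt (- x)) (at x)"
      unfolding v_def by (intro DERIV_mult ds DERIV_fun_sin d\<phi>)
    also have "(- 1 / (2 * s)) * sin (\<phi> x) + (cos (\<phi> x) * (- \<mu> / (s * s))) * sqrt (- x) = v' x"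
      unfolding v'_def s_def[symmetric] using s(1) by (simp add: field_simps)
    finally show "(v has_real_derivative v' x) (at x)" .
    define n where "n = (\<lambda>x. - ((1 / 2) * sin (\<phi> x) + \<mu> * cos (\<phi> x)))"
    have v'_eq: "v' = (\<lambda>x. n x / sqrt (- x))"
      by (simp add: v'_def n_def)
    have "(n has_real_derivative - ((1 / 2) * (cos (\<phi> x) * (- \<mu> / (s * s))) + \<mu> * (- sin (\<phi> x) * (- \<mu> / (s * s))))) (at x)"
      unfolding n_def by (intro DERIV_minus DERIV_add DERIV_cmult DERIV_fun_sin DERIV_fun_cos d\<phi>)
    then have "(v' has_real_derivative
       ((- ((1 / 2) * (cos (\<phi> x) * (- \<mu> / (s * s))) + \<mu> * (- sin (\<phi> x) * (- \<mu> / (s * s))))) * sqrt (- x)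
          - n x * (- 1 / (2 * s))) / (sqrt (- x) * sqrt (- x))) (at x)"
      unfolding v'_eq using ds s(1) by (intro DERIV_divide) (auto simp: s_def)
    also have "((- ((1 / 2) * (cos (\<phi> x) * (- \<mu> / (s * s))) + \<mu> * (- sin (\<phi> x) * (- \<mu> / (s * s))))) * sqrt (- x)
          - n x * (- 1 / (2 * s))) / (sqrt (- x) * sqrt (- x)) = (- (1 / 4 + \<mu>\<^sup>2) / x\<^sup>2) * v x"
      unfolding v_def n_def s_def[symmetric] s(2) using s(1)
      by (simp add: divide_simps power2_eq_square) (simp add: algebra_simps)
    finally show "(v' has_real_derivative (- (1 / 4 + \<mu>\<^sup>2) / x\<^sup>2) * v x) (at x)" .
  qed
  have "v x \<ge> 0" if "a \<le> x" "x \<le> b" for x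
  proof -
    have "ln (- b) \<le> ln (- x)" "ln (- x) \<le> ln (- a)"
      using that \<open>b < 0\<close> by auto
    then have "\<phi> b \<le> \<phi> x" "\<phi> x \<le> \<phi> a"
      using \<open>\<mu> > 0\<close> by (auto simp: \<phi>_def)
    then show ?thesis
      using that \<open>b < 0\<close> by (auto simp: v_def \<phi> intro!: mult_nonneg_nonneg sin_ge_zero)
  qed
  moreover have "v a = 0" "v b = 0" "v' a \<ge> 0" "v' b < 0"
    using \<open>a < b\<close> \<open>b < 0\<close> \<open>\<mu> > 0\<close> by (auto simp: v_def v'_def \<phi>)
  moreover have "\<theta> a - k * pi \<ge> 0"
    using assms by (simp add: a_def)
  ultimately have "\<theta> b - k * pi \<ge> pi"
    using prufer_sturm_comparison_zero[OF prufer_shift[OF \<theta>, of k] assms(2) \<open>a < b\<close>,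
        of v v' "\<lambda>x. - (1 / 4 + \<mu>\<^sup>2) / x\<^sup>2"] der U
    unfolding a_def b_def by blast
  then show ?thesis by (simp add: b_def algebra_simps)
qed

text \<open>The arcs are consecutive, each of length \<open>pi / \<mu>\<close> in the variable
  \<open>ln (- x)\<close>, and each adds pi to the angle.\<close>

lemma prufer_advance_inverse_square_iterated:
  fixes j N :: nat
  assumes "prufer U E \<theta>" "continuous_on UNIV U" "\<mu> > 0"
    and U: "\<And>x. - exp ((j + N) * pi / \<mu>) \<le> x \<Longrightarrow> x \<le> - exp (j * pi / \<mu>) \<Longrightarrow>
               U x - E \<le> - (1 / 4 + \<mu>\<^sup>2) / x\<^sup>2"
    and "\<theta> (- exp ((j + N) * pi / \<mu>)) \<ge> 0"
  shows "\<theta> (- exp (j * pi / \<mu>)) \<ge> N * pi"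
proof -
  have mono: "exp (real m * pi / \<mu>) \<le> exp (real n * pi / \<mu>)" if "m \<le> n" for m n
    using that \<open>\<mu> > 0\<close> by (auto intro!: divide_right_mono mult_right_mono)
  \<comment> \<open>Moving right along the negative axis lowers the exponent, hence the index
    \<open>j + N - i\<close> after \<open>i\<close> arcs.\<close>
  have "\<theta> (- exp (real (j + N - i) * pi / \<mu>)) \<ge> i * pi" if "i \<le> N" for i
    using that
  proof (induction i)
    case 0
    then show ?case using assms(5) by simp
  next
    case (Suc i)
    define m where "m = j + N - Suc i"
    have m: "Suc m = j + N - i" "j \<le> m" "Suc m \<le> j + N" using Suc.prems by (auto simp: m_def)
    have "\<theta> (- exp (m * pi / \<mu>)) \<ge> (int i + 1) * pi"
    proof (rule prufer_advance_inverse_square[OF assms(1-3), of m "int i"])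
      fix x assume x: "- exp (real (Suc m) * pi / \<mu>) \<le> x" "x \<le> - exp (real m * pi / \<mu>)"
      show "U x - E \<le> - (1 / 4 + \<mu>\<^sup>2) / x\<^sup>2"
        using x mono[OF m(2)] mono[OF m(3)] by (intro U) linarith+
    next
      show "of_int (int i) * pi \<le> \<theta> (- exp (real (Suc m) * pi / \<mu>))"
        using Suc unfolding m(1) by simp
    qed
    then show ?case by (simp add: m_def add.commute)
  qed
  from this[of N] show ?thesis by simp
qed

text \<open>On the forbidden tails the angle cannot rise past the next level
  \<open>k * pi + pi / 2\<close>, and on \<open>[- M, M]\<close> its speed is at most
  \<open>D\<close>. Neither bound depends on \<open>n\<close>.\<close>

lemma prufer_angle_bounded_below_spectrum:
  assumes "continuous_on UNIV U" "\<And>x. \<bar>U x\<bar> \<le> B" and "M > 0"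
    and M: "\<And>x. \<bar>x\<bar> \<ge> M \<Longrightarrow> E < U x"
  obtains K :: nat where "\<And>\<theta> n. prufer U E \<theta> \<Longrightarrow> \<theta> (- n) = 0 \<Longrightarrow> n > M \<Longrightarrow> \<theta> n \<le> K * pi"
proof -
  define D where "D = 1 + (\<bar>E\<bar> + B)"
  have "B \<ge> 0" using assms(2)[of 0] by linarith
  obtain k :: nat where k: "2 * M * D \<le> k * pi"
    using reals_Archimedean3[OF pi_gt_zero] by (metis less_imp_le)
  show ?thesis
  \<comment> \<open>\<open>k\<close> pays for the growth on \<open>[- M, M]\<close>; one more unit
    absorbs the extra \<open>pi / 2\<close> from the tails.\<close>
  proof (rule that[of "Suc k"])
    fix \<theta> n assume \<theta>: "prufer U E \<theta>" "\<theta> (- n) = 0" "n > M"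
    have "\<theta> (- M) < pi / 2"
      using prufer_forbidden_crossing[OF \<theta>(1), of "- n" 0 "- M"] \<theta> M \<open>M > 0\<close> by simp
    moreover have "D * (- M) - \<theta> (- M) \<le> D * M - \<theta> M"
    proof (rule deriv_nonneg_mono[of "- M" M])
      fix x
      show "((\<lambda>x. D * x - \<theta> x) has_real_derivative D - ((cos (\<theta> x))\<^sup>2 + (E - U x) * (sin (\<theta> x))\<^sup>2)) (at x)"
        by (auto intro!: derivative_eq_intros pruferD \<theta>)
      have "\<bar>E - U x\<bar> \<le> \<bar>E\<bar> + B" using assms(2)[of x] by linarith
      then show "0 \<le> D - ((cos (\<theta> x))\<^sup>2 + (E - U x) * (sin (\<theta> x))\<^sup>2)"
        using prufer_rhs_bound[of "E - U x" "\<bar>E\<bar> + B" "\<theta> x"] unfolding D_def by linarith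
    qed (use \<open>M > 0\<close> in simp)
    ultimately have "\<theta> M \<le> of_int (int k) * pi + pi / 2"
      using k by (simp add: algebra_simps)
    then have "\<theta> n < of_int (int k) * pi + pi / 2"
      using prufer_forbidden_crossing[OF \<theta>(1), of M "int k" n] \<theta> M \<open>M > 0\<close> by simp
    then show "\<theta> n \<le> Suc k * pi"
      using pi_gt_zero unfolding of_nat_Suc distrib_right of_int_of_nat_eq by linarith
  qed
qed

text \<open>A strength above \<open>1 / 4\<close> fits any number of arcs into the tail;
  \<open>K\<close> of them occupy a bounded stretch, on which a small enough energy shift is
  harmless.\<close>

lemma prufer_angle_unbounded_near_zero:
  fixes K :: nat
  assumes "continuous_on UNIV U" and "c > 1 / 4"
    and M: "\<And>x. x \<le> - M \<Longrightarrow> U x \<le> - c / x\<^sup>2"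
  obtains \<delta>\<^sub>0 A where "\<delta>\<^sub>0 > 0" "A > 0"
    "\<And>\<delta> \<theta> n. \<delta> \<le> \<delta>\<^sub>0 \<Longrightarrow> prufer U (- \<delta>) \<theta> \<Longrightarrow> \<theta> (- n) = 0 \<Longrightarrow> n > A \<Longrightarrow> \<theta> n \<ge> K * pi"
proof -
  \<comment> \<open>\<open>1 / 4 + \<mu>\<^sup>2\<close> is the midpoint of \<open>1 / 4\<close> and
    \<open>c\<close>; the other half of the gap is reserved for the energy.\<close>
  define \<mu> where "\<mu> = sqrt ((c - 1 / 4) / 2)"
  have \<mu>: "\<mu> > 0" "\<mu>\<^sup>2 = (c - 1 / 4) / 2" using \<open>c > 1 / 4\<close> by (auto simp: \<mu>_def)
  \<comment> \<open>This \<open>j\<close> places all arcs to the left of \<open>- M\<close>, since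
    \<open>exp\<close> dominates its argument.\<close>
  obtain j :: nat where j: "M * \<mu> < j * pi"
    using reals_Archimedean3[OF pi_gt_zero] by metis
  define A where "A = exp ((j + K) * pi / \<mu>)"
  define b where "b = exp (j * pi / \<mu>)"
  \<comment> \<open>On \<open>[- A, - b]\<close> one has \<open>x\<^sup>2 \<le> A\<^sup>2\<close>,
    so \<open>\<delta>\<^sub>0\<close> is at most the reserve
    \<open>(c - 1 / 4) / 2 / x\<^sup>2\<close>.\<close>
  define \<delta>\<^sub>0 where "\<delta>\<^sub>0 = (c - 1 / 4) / 2 / A\<^sup>2"
  have "M \<le> b"
  proof -
    have "M \<le> j * pi / \<mu>" using j \<mu> by (simp add: field_simps)
    also have "\<dots> \<le> b" unfolding b_def using exp_ge_add_one_self[of "j * pi / \<mu>"] by linarith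
    finally show ?thesis .
  qed
  show ?thesis
  proof (rule that[of \<delta>\<^sub>0 A])
    show "A > 0" by (simp add: A_def)
    then show "\<delta>\<^sub>0 > 0" using \<open>c > 1 / 4\<close> by (simp add: \<delta>\<^sub>0_def)
    fix \<delta> \<theta> n assume "\<delta> \<le> \<delta>\<^sub>0" and \<theta>: "prufer U (- \<delta>) \<theta>" "\<theta> (- n) = 0" "n > A"
    have "\<theta> (- b) \<ge> K * pi"
      unfolding b_def
    proof (rule prufer_advance_inverse_square_iterated[OF \<theta>(1) assms(1) \<mu>(1)])
      show "0 \<le> \<theta> (- exp (real (j + K) * pi / \<mu>))"
        using prufer_crosses_upward[OF \<theta>(1), of 0 "- n" "- A"] \<theta> by (simp add: A_def)
      fix x assume x: "- exp (real (j + K) * pi / \<mu>) \<le> x" "x \<le> - exp (real j * pi / \<mu>)"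
      then have "- A \<le> x" "x \<le> - b" "x < 0"
        using exp_gt_zero[of "real j * pi / \<mu>"] by (auto simp: A_def b_def simp del: exp_gt_zero)
      then have "x\<^sup>2 \<le> A\<^sup>2" "x\<^sup>2 > 0"
        by (auto simp: abs_le_square_iff[symmetric])
      then have "\<delta>\<^sub>0 \<le> (c - 1 / 4) / 2 / x\<^sup>2"
        unfolding \<delta>\<^sub>0_def using \<open>c > 1 / 4\<close> \<open>A > 0\<close> by (intro divide_left_mono mult_pos_pos) auto
      moreover have "U x \<le> - c / x\<^sup>2"
        using \<open>x \<le> - b\<close> \<open>M \<le> b\<close> by (intro M) auto
      ultimately have "U x - - \<delta> \<le> - c / x\<^sup>2 + (c - 1 / 4) / 2 / x\<^sup>2"
        using \<open>\<delta> \<le> \<delta>\<^sub>0\<close> by linarith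
      also have "\<dots> = - (1 / 4 + \<mu>\<^sup>2) / x\<^sup>2"
        unfolding \<mu>(2) using \<open>x\<^sup>2 > 0\<close> by (simp add: field_simps)
      finally show "U x - - \<delta> \<le> - (1 / 4 + \<mu>\<^sup>2) / x\<^sup>2" .
    qed
    moreover have "- b < n"
      using \<theta>(3) exp_gt_zero[of "real j * pi / \<mu>"] \<open>A > 0\<close> unfolding b_def by linarith
    ultimately show "\<theta> n \<ge> K * pi"
      using prufer_crosses_upward[OF \<theta>(1), of "int K" "- b" n] by simp
  qed
qed

section \<open>Existence of bound states\<close>

text \<open>A bounded monotone antiderivative has limits at both ends, as the fundamental theorem on
  the whole line requires.\<close>

lemma integrable_of_bounded_antiderivative:
  fixes f F :: "real \<Rightarrow> real"
  assumes F: "\<And>x. (F has_real_derivative f x) (at x)" and f: "continuous_on UNIV f" "\<And>x. 0 \<le> f x"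
    and C: "\<And>x. \<bar>F x\<bar> \<le> C"
  shows "integrable lborel f"
proof -
  have mono: "F x \<le> F y" if "x \<le> y" for x y
    using that F f(2) by (rule deriv_nonneg_mono)
  have bdd: "bdd_above (range F)" "bdd_below (range F)"
    using C by (auto simp: abs_le_iff intro!: bdd_aboveI[of _ C] bdd_belowI[of _ "- C"])
       (metis minus_le_iff)
  have "(F \<longlongrightarrow> (SUP x. F x)) at_top"
  proof (rule order_tendstoI)
    fix a assume "a < (SUP x. F x)"
    then obtain x0 where "a < F x0" using bdd by (auto simp: less_cSUP_iff)
    then show "\<forall>\<^sub>F x in at_top. a < F x"
      using mono[of x0] by (intro eventually_mono[OF eventually_ge_at_top[of x0]]) force
  next
    fix a assume "a > (SUP x. F x)"
    then show "\<forall>\<^sub>F x in at_top. F x < a"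
      using cSUP_upper[OF UNIV_I bdd(1)] by (intro always_eventually allI) (meson le_less_trans)
  qed
  moreover have "(F \<longlongrightarrow> (INF x. F x)) at_bot"
  proof (rule order_tendstoI)
    fix a assume "a > (INF x. F x)"
    then obtain x0 where "a > F x0" using bdd by (auto simp: cINF_less_iff)
    then show "\<forall>\<^sub>F x in at_bot. F x < a"
      using mono[of _ x0] by (intro eventually_mono[OF eventually_le_at_bot[of x0]]) force
  next
    fix a assume "a < (INF x. F x)"
    then show "\<forall>\<^sub>F x in at_bot. a < F x"
      using cINF_lower[OF bdd(2) UNIV_I] by (intro always_eventually allI) (meson less_le_trans)
  qed
  ultimately have "set_integrable lborel (einterval (- \<infinity>) \<infinity>) f"
    using F f by (intro interval_integral_FTC_nonneg(1)[of _ _ F])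
      (auto simp: ereal_tendsto_simps1 continuous_on_eq_continuous_at)
  then show ?thesis by (simp add: set_integrable_def)
qed

lemma antiderivative_le_integral:
  fixes f F :: "real \<Rightarrow> real"
  assumes "integrable lborel f" "\<And>x. 0 \<le> f x" "continuous_on UNIV f"
    and F: "\<And>x. (F has_real_derivative f x) (at x)" and "x \<le> y"
  shows "F y - F x \<le> integral\<^sup>L lborel f"
proof -
  have "F y - F x = integral\<^sup>L lborel (\<lambda>z. indicator {x..y} z *\<^sub>R f z)"
    using F continuous_on_subset[OF assms(3)]
    by (intro integral_FTC_atLeastAtMost[symmetric] \<open>x \<le> y\<close>)
       (auto simp: has_real_derivative_iff_has_vector_derivative intro: has_vector_derivative_at_within)
  also have "\<dots> \<le> integral\<^sup>L lborel f"
    using assms by (intro integral_mono integrable_mult_indicator) (auto simp: indicator_def)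
  finally show ?thesis .
qed

section \<open>Continuous dependence of the angle on energy and initial value\<close>

lemma prufer_terminal_continuous:
  assumes U: "continuous_on UNIV U" "\<And>x. \<bar>U x\<bar> \<le> B"
    and \<Theta>: "\<And>E. prufer U E (\<Theta> E)" "\<And>E. \<Theta> E a = t0"
  shows "continuous_on S (\<lambda>E. \<Theta> E b)"
proof (intro continuous_at_imp_continuous_on ballI)
  fix E0
  define L where "L = exp ((5 + 4 * (\<bar>E0\<bar> + B)) * \<bar>b - a\<bar>)"
  have "norm (\<Theta> E b - \<Theta> E0 b) \<le> sqrt L * \<bar>E - E0\<bar>" for E
  proof -
    have "(\<Theta> E0 b - \<Theta> E b)\<^sup>2 + (E0 - E)\<^sup>2 \<le> (E0 - E)\<^sup>2 * L"
      using prufer_dist[OF \<Theta>(1) \<Theta>(1) U(2), of E0 b E a] \<Theta>(2) by (simp add: L_def)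
    then have "(\<Theta> E b - \<Theta> E0 b)\<^sup>2 \<le> L * (E - E0)\<^sup>2"
      using zero_le_power2[of "E0 - E"]
      unfolding power2_commute[of "\<Theta> E0 b"] power2_commute[of E0] mult.commute[of L] by linarith
    then have "sqrt ((\<Theta> E b - \<Theta> E0 b)\<^sup>2) \<le> sqrt (L * (E - E0)\<^sup>2)"
      by (rule real_sqrt_le_mono)
    then show ?thesis by (simp add: real_sqrt_mult)
  qed
  then have "\<forall>\<^sub>F E in at E0. norm (\<Theta> E b - \<Theta> E0 b) \<le> sqrt L * \<bar>E - E0\<bar>"
    by (intro always_eventually allI)
  moreover have "((\<lambda>E. sqrt L * \<bar>E - E0\<bar>) \<longlongrightarrow> 0) (at E0)"
    by (auto intro!: tendsto_eq_intros)
  ultimately have "((\<lambda>E. \<Theta> E b - \<Theta> E0 b) \<longlongrightarrow> 0) (at E0)"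
    by (rule Lim_null_comparison)
  then show "isCont (\<lambda>E. \<Theta> E b) E0"
    unfolding isCont_def by (rule LIM_zero_cancel)
qed

lemma prufer_tendsto:
  assumes B: "\<And>x. \<bar>U x\<bar> \<le> B" and \<theta>: "\<And>i :: nat. prufer U (E i) (\<theta> i)" "prufer U E' \<theta>'"
    and lim: "E \<longlonglongrightarrow> E'" "(\<lambda>i. \<theta> i a) \<longlonglongrightarrow> \<theta>' a"
  shows "(\<lambda>i. \<theta> i x) \<longlonglongrightarrow> \<theta>' x"
proof -
  define L where "L = exp ((5 + 4 * (\<bar>E'\<bar> + B)) * \<bar>x - a\<bar>)"
  have "norm ((\<theta>' x - \<theta> i x)\<^sup>2) \<le> ((\<theta>' a - \<theta> i a)\<^sup>2 + (E' - E i)\<^sup>2) * L" for i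
    using prufer_dist[OF \<theta>(2) \<theta>(1)[of i] B, of x a] zero_le_power2[of "E' - E i"]
    unfolding L_def real_norm_def abs_of_nonneg[OF zero_le_power2] by linarith
  then have "\<forall>\<^sub>F i in sequentially. norm ((\<theta>' x - \<theta> i x)\<^sup>2) \<le> ((\<theta>' a - \<theta> i a)\<^sup>2 + (E' - E i)\<^sup>2) * L"
    by (intro always_eventually allI)
  moreover have "(\<lambda>i. ((\<theta>' a - \<theta> i a)\<^sup>2 + (E' - E i)\<^sup>2) * L) \<longlonglongrightarrow> 0"
  proof -
    have "(\<lambda>i. ((\<theta>' a - \<theta> i a)\<^sup>2 + (E' - E i)\<^sup>2) * L) \<longlonglongrightarrow> ((\<theta>' a - \<theta>' a)\<^sup>2 + (E' - E')\<^sup>2) * L"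
      by (intro tendsto_intros lim)
    then show ?thesis by simp
  qed
  ultimately have "(\<lambda>i. (\<theta>' x - \<theta> i x)\<^sup>2) \<longlonglongrightarrow> 0"
    by (rule Lim_null_comparison)
  then have "(\<lambda>i. sqrt ((\<theta>' x - \<theta> i x)\<^sup>2)) \<longlonglongrightarrow> sqrt 0"
    by (rule tendsto_real_sqrt)
  then have "(\<lambda>i. \<theta>' x - \<theta> i x) \<longlonglongrightarrow> 0"
    by (simp add: tendsto_rabs_zero_iff)
  from tendsto_diff[OF tendsto_const[of "\<theta>' x"] this] show ?thesis by simp
qed

text \<open>Here \<open>w w'\<close> is nondecreasing near both ends with the sign that makes it bounded, so
  \<open>(w w')' \<ge> \<eta> w\<^sup>2\<close> gives square integrability without any decay estimate.\<close>

lemma bound_state_of_prufer: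
  assumes U: "continuous_on UNIV U" and \<theta>: "prufer U E \<theta>" and "\<eta> > 0" "M > 0"
    and gap: "\<And>x. \<bar>x\<bar> \<ge> M \<Longrightarrow> U x - E \<ge> \<eta>"
    and left: "\<And>x. x \<le> - M \<Longrightarrow> sin (\<theta> x) * cos (\<theta> x) \<ge> 0"
    and right: "\<And>x. x \<ge> M \<Longrightarrow> sin (\<theta> x) * cos (\<theta> x) \<le> 0"
  shows "\<exists>w. bound_state U E w"
proof -
  obtain R where R: "\<And>x. R x > 0"
    "\<And>x. ((\<lambda>x. R x * sin (\<theta> x)) has_real_derivative R x * cos (\<theta> x)) (at x)"
    "\<And>x. ((\<lambda>x. R x * cos (\<theta> x)) has_real_derivative (U x - E) * (R x * sin (\<theta> x))) (at x)"
    by (rule prufer_amplitude[OF \<theta> U]) (rule that)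
  define w where "w = (\<lambda>x. R x * sin (\<theta> x))"
  define w' where "w' = (\<lambda>x. R x * cos (\<theta> x))"
  have w: "(w has_real_derivative w' x) (at x)" "(w' has_real_derivative (U x - E) * w x) (at x)" for x
    using R(2,3)[of x] by (simp_all add: w_def w'_def)
  have cont: "continuous_on UNIV (\<lambda>x. (w x)\<^sup>2)"
    using w(1) by (intro continuous_intros) (meson DERIV_isCont continuous_at_imp_continuous_on)
  then obtain P where P: "\<And>x. (P has_real_derivative (w x)\<^sup>2) (at x)"
    by (rule continuous_antiderivative) (rule that)
  \<comment> \<open>Division by \<open>\<eta>\<close> gives \<open>F' \<ge> w\<^sup>2\<close> on the
    tails, so that \<open>F - P\<close> is nondecreasing there.\<close>
  define F where "F = (\<lambda>x. w x * w' x / \<eta>)"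
  have FP: "F a - P a \<le> F b - P b" if "a \<le> b" "\<And>x. a \<le> x \<Longrightarrow> x \<le> b \<Longrightarrow> \<bar>x\<bar> \<ge> M" for a b
  proof (rule deriv_nonneg_mono[OF that(1)])
    fix x assume x: "a \<le> x" "x \<le> b"
    show "((\<lambda>x. F x - P x) has_real_derivative ((w' x)\<^sup>2 + (U x - E) * (w x)\<^sup>2) / \<eta> - (w x)\<^sup>2) (at x)"
      unfolding F_def
      by (rule DERIV_cong[OF DERIV_diff[OF DERIV_cdivide[OF DERIV_mult[OF w(1) w(2)]] P]])
         (simp add: power2_eq_square)
    have "\<eta> * (w x)\<^sup>2 \<le> (U x - E) * (w x)\<^sup>2"
      using gap[OF that(2)[OF x]] by (intro mult_right_mono) auto
    then have "\<eta> * (w x)\<^sup>2 \<le> (w' x)\<^sup>2 + (U x - E) * (w x)\<^sup>2"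
      using zero_le_power2[of "w' x"] by linarith
    then show "0 \<le> ((w' x)\<^sup>2 + (U x - E) * (w x)\<^sup>2) / \<eta> - (w x)\<^sup>2"
      using \<open>\<eta> > 0\<close> by (simp add: field_simps)
  qed
  have F_eq: "F x = R x * R x * (sin (\<theta> x) * cos (\<theta> x)) / \<eta>" for x
    by (simp add: F_def w_def w'_def)
  have F_right: "F x \<le> 0" if "x \<ge> M" for x
    unfolding F_eq using \<open>\<eta> > 0\<close>
    by (intro divide_nonpos_pos mult_nonneg_nonpos[OF _ right[OF that]]) auto
  have F_left: "F x \<ge> 0" if "x \<le> - M" for x
    unfolding F_eq using \<open>\<eta> > 0\<close>
    by (intro divide_nonneg_pos mult_nonneg_nonneg[OF _ left[OF that]]) auto
  have P_mono: "P x \<le> P y" if "x \<le> y" for x y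
    using that P by (rule deriv_nonneg_mono) simp
  \<comment> \<open>Beyond \<open>M\<close> the growth of \<open>P\<close> is at most that of
    \<open>F\<close>, and \<open>F \<le> 0\<close> there; \<open>max x M\<close> covers the
    remaining \<open>x\<close> by monotonicity of \<open>P\<close>.\<close>
  have "P x \<le> P M - F M" for x
    using P_mono[of x "max x M"] FP[of M "max x M"] F_right[of "max x M"] \<open>M > 0\<close> by force
  moreover have "P (- M) - F (- M) \<le> P x" for x
    using P_mono[of "min x (- M)" x] FP[of "min x (- M)" "- M"] F_left[of "min x (- M)"] \<open>M > 0\<close> by force
  ultimately have "\<bar>P x\<bar> \<le> \<bar>P M - F M\<bar> + \<bar>P (- M) - F (- M)\<bar>" for x
    by (smt (verit))
  then have int: "integrable lborel (\<lambda>x. (w x)\<^sup>2)"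
    using integrable_of_bounded_antiderivative[OF P cont] by auto
  have "\<exists>x. w x \<noteq> 0"
  proof (rule ccontr)
    assume "\<not> (\<exists>x. w x \<noteq> 0)"
    then have w0: "w x = 0" for x by simp
    then have "(w has_real_derivative 0) (at 0)"
      by (subst ext[of w "\<lambda>_. 0"]) auto
    then have "w' 0 = 0" by (rule DERIV_unique[OF w(1)])
    then have "sin (\<theta> 0) = 0" "cos (\<theta> 0) = 0"
      using w0[of 0] R(1)[of 0] by (simp_all add: w_def w'_def)
    then show False
      using sin_cos_squared_add[of "\<theta> 0"] by simp
  qed
  then have "bound_state U E (\<lambda>x. complex_of_real (w x))"
    unfolding bound_state_def
    using int w
    by (intro conjI exI[of _ "\<lambda>x. complex_of_real (w' x)"]
         exI[of _ "\<lambda>x. complex_of_real ((U x - E) * w x)"] allI has_vector_derivative_of_real)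
       (auto simp: has_real_derivative_iff_has_vector_derivative algebra_simps)
  then show ?thesis by blast
qed

text \<open>The terminal angle depends continuously on the energy, so the intermediate value theorem
  applies. Both end values of the angle say that \<open>w\<close> vanishes there.\<close>

lemma prufer_shooting:
  fixes K :: nat
  assumes U: "continuous_on UNIV U" "\<And>x. \<bar>U x\<bar> \<le> B" and "Ea \<le> Eb"
    and low: "\<And>\<theta>. prufer U Ea \<theta> \<Longrightarrow> \<theta> a = 0 \<Longrightarrow> \<theta> b \<le> K * pi"
    and high: "\<And>\<theta>. prufer U Eb \<theta> \<Longrightarrow> \<theta> a = 0 \<Longrightarrow> \<theta> b \<ge> K * pi"
  obtains E \<theta> where "Ea \<le> E" "E \<le> Eb" "prufer U E \<theta>" "\<theta> a = 0" "\<theta> b = K * pi"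
proof -
  have "\<forall>E. \<exists>\<theta>. prufer U E \<theta> \<and> \<theta> a = 0"
    using prufer_exists[OF U] by metis
  then obtain \<Theta> where \<Theta>: "\<And>E. prufer U E (\<Theta> E)" "\<And>E. \<Theta> E a = 0"
    by metis
  have "\<exists>E\<ge>Ea. E \<le> Eb \<and> \<Theta> E b = K * pi"
  proof (rule IVT')
    show "\<Theta> Ea b \<le> K * pi" "K * pi \<le> \<Theta> Eb b"
      using low[OF \<Theta>] high[OF \<Theta>] by auto
    show "continuous_on {Ea..Eb} (\<lambda>E. \<Theta> E b)"
      by (rule prufer_terminal_continuous[OF U \<Theta>])
  qed fact
  then show ?thesis
    using that \<Theta> by metis
qed

text \<open>An angle above \<open>pi / 2\<close> on the left would have crossed a blocked level; one
  below \<open>K * pi - pi / 2\<close> on the right could never recover to \<open>K * pi\<close>.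
  The bound at 0 supplies compactness for the limit of large \<open>n\<close>.\<close>

lemma prufer_dirichlet_tails:
  fixes K :: nat
  assumes \<theta>: "prufer U E \<theta>" "\<theta> (- n) = 0" "\<theta> n = K * pi"
    and M: "M > 0" "\<And>x. \<bar>x\<bar> \<ge> M \<Longrightarrow> E < U x"
  shows "- n \<le> x \<Longrightarrow> x \<le> - M \<Longrightarrow> 0 \<le> \<theta> x \<and> \<theta> x \<le> pi / 2"
    and "M \<le> x \<Longrightarrow> x \<le> n \<Longrightarrow> K * pi - pi / 2 \<le> \<theta> x \<and> \<theta> x \<le> K * pi"
    and "n > 0 \<Longrightarrow> 0 \<le> \<theta> 0 \<and> \<theta> 0 \<le> K * pi"
proof -
  have pos: "0 \<le> \<theta> x" if "- n \<le> x" for x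
    using prufer_crosses_upward[OF \<theta>(1), of 0 "- n" x] \<theta>(2) that by (cases "x = - n") auto
  have le: "\<theta> x \<le> K * pi" if "x \<le> n" for x
    using prufer_crosses_upward[OF \<theta>(1), of "int K" x n] \<theta>(3) that by (cases "x = n") force+
  show "0 \<le> \<theta> x \<and> \<theta> x \<le> pi / 2" if "- n \<le> x" "x \<le> - M"
  proof (cases "x = - n")
    case False
    then show ?thesis
      using prufer_forbidden_crossing[OF \<theta>(1), of "- n" 0 x] \<theta>(2) that M pos[of x] by force
  qed (use \<theta> in simp)
  show "K * pi - pi / 2 \<le> \<theta> x \<and> \<theta> x \<le> K * pi" if x: "M \<le> x" "x \<le> n"
  proof -
    have "K * pi - pi / 2 \<le> \<theta> x"
    proof (rule ccontr)
      assume *: "\<not> K * pi - pi / 2 \<le> \<theta> x"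
      then have "x < n" using \<theta>(3) x(2) by (cases "x = n") auto
      moreover have "\<theta> x \<le> of_int (int K - 1) * pi + pi / 2"
        using * by (simp add: left_diff_distrib)
      ultimately have "\<theta> n < of_int (int K - 1) * pi + pi / 2"
        using x M by (intro prufer_forbidden_crossing[OF \<theta>(1), of x]) auto
      then show False using \<theta>(3) pi_gt_zero by (simp add: left_diff_distrib)
    qed
    then show ?thesis using le[OF x(2)] by simp
  qed
  show "0 \<le> \<theta> 0 \<and> \<theta> 0 \<le> K * pi" if "n > 0"
    using pos[of 0] le[of 0] that by simp
qed

text \<open>The bound state is a limit, as \<open>n \<rightarrow> \<infinity>\<close>, of Dirichlet eigenfunctions on \<open>[-n, n]\<close> with \<open>K - 1\<close>
  interior zeros, whose eigenvalues stay in a fixed compact subinterval of \<open>(- \<infinity>, 0)\<close>.\<close>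

lemma bound_state_near_zero:
  fixes c \<epsilon> :: real
  assumes U: "continuous_on UNIV U" "\<And>x. \<bar>U x\<bar> \<le> B"
    and small: "\<And>\<eta>. \<eta> > 0 \<Longrightarrow> \<exists>M>0. \<forall>x. \<bar>x\<bar> \<ge> M \<longrightarrow> U x \<ge> - \<eta>"
    and "c > 1 / 4" and tail: "\<And>x. x \<le> - M\<^sub>0 \<Longrightarrow> U x \<le> - c / x\<^sup>2" and "\<epsilon> > 0"
  shows "\<exists>E w. - \<epsilon> \<le> E \<and> E < 0 \<and> bound_state U E w"
proof -
  obtain M1 where M1: "M1 > 0" "\<And>x. \<bar>x\<bar> \<ge> M1 \<Longrightarrow> U x \<ge> - (\<epsilon> / 2)"
    using small[of "\<epsilon> / 2"] \<open>\<epsilon> > 0\<close> by auto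
  have "- \<epsilon> < U x" if "\<bar>x\<bar> \<ge> M1" for x
    using M1(2)[OF that] \<open>\<epsilon> > 0\<close> by linarith
  then obtain K :: nat where
    K: "\<And>\<theta> n. prufer U (- \<epsilon>) \<theta> \<Longrightarrow> \<theta> (- n) = 0 \<Longrightarrow> n > M1 \<Longrightarrow> \<theta> n \<le> K * pi"
    using prufer_angle_bounded_below_spectrum[OF U M1(1)] by metis
  obtain \<delta>\<^sub>0 A where \<delta>\<^sub>0: "\<delta>\<^sub>0 > 0" "A > 0"
    "\<And>\<delta> \<theta> n. \<delta> \<le> \<delta>\<^sub>0 \<Longrightarrow> prufer U (- \<delta>) \<theta> \<Longrightarrow> \<theta> (- n) = 0 \<Longrightarrow> n > A \<Longrightarrow> \<theta> n \<ge> K * pi"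
    using prufer_angle_unbounded_near_zero[OF U(1) \<open>c > 1 / 4\<close> tail] by metis
  \<comment> \<open>The minimum keeps \<open>[- \<epsilon>, - \<delta>]\<close> nonempty; its right
    end is negative, so a limit of energies cannot escape to 0.\<close>
  define \<delta> where "\<delta> = min \<delta>\<^sub>0 \<epsilon>"
  have \<delta>: "\<delta> > 0" "\<delta> \<le> \<delta>\<^sub>0" "\<delta> \<le> \<epsilon>" using \<delta>\<^sub>0 \<open>\<epsilon> > 0\<close> by (auto simp: \<delta>_def)
  \<comment> \<open>This \<open>M\<close> serves every energy up to \<open>- \<delta>\<close>, so
    the tail bounds are uniform in \<open>i\<close>.\<close>
  obtain M where M: "M > 0" "\<And>x. \<bar>x\<bar> \<ge> M \<Longrightarrow> U x \<ge> - (\<delta> / 2)"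
    using small[of "\<delta> / 2"] \<delta> by auto
  define n where "n = (\<lambda>i :: nat. max M1 A + 1 + real i)"
  have n: "n i > M1" "n i > A" "n i > 0" for i
    using \<delta>\<^sub>0(2) by (auto simp: n_def)
  have "\<exists>E \<theta>. - \<epsilon> \<le> E \<and> E \<le> - \<delta> \<and> prufer U E \<theta> \<and> \<theta> (- n i) = 0 \<and> \<theta> (n i) = K * pi" for i
  proof (rule prufer_shooting[OF U, of "- \<epsilon>" "- \<delta>" "- n i" "n i" K])
    show "- \<epsilon> \<le> - \<delta>" using \<delta>(3) by simp
    show "\<theta> (n i) \<le> K * pi" if "prufer U (- \<epsilon>) \<theta>" "\<theta> (- n i) = 0" for \<theta>
      using K[OF that n(1)] .
    show "\<theta> (n i) \<ge> K * pi" if "prufer U (- \<delta>) \<theta>" "\<theta> (- n i) = 0" for \<theta>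
      using \<delta>\<^sub>0(3)[OF \<delta>(2) that n(2)] .
  qed blast
  then obtain E \<theta> where E: "\<And>i. - \<epsilon> \<le> E i" "\<And>i. E i \<le> - \<delta>"
    and \<theta>: "\<And>i. prufer U (E i) (\<theta> i)" "\<And>i. \<theta> i (- n i) = 0" "\<And>i. \<theta> i (n i) = K * pi"
    by metis
  have gap: "E i < U x" if "\<bar>x\<bar> \<ge> M" for i x
    using M(2)[OF that] E(2)[of i] \<delta>(1) by linarith
  note tails = prufer_dirichlet_tails[OF \<theta> M(1) gap]
  \<comment> \<open>The angles are compared at 0, because the starting points \<open>- n i\<close>
    run off to infinity.\<close>
  have "compact ({0..K * pi} \<times> {- \<epsilon>..- \<delta>})"
    by (intro compact_Times compact_Icc)
  moreover have "\<forall>i. (\<theta> i 0, E i) \<in> {0..K * pi} \<times> {- \<epsilon>..- \<delta>}"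
    using tails(3) n(3) E by auto
  ultimately obtain l r where l: "l \<in> {0..K * pi} \<times> {- \<epsilon>..- \<delta>}" "strict_mono r"
    "((\<lambda>i. (\<theta> i 0, E i)) \<circ> r) \<longlonglongrightarrow> l"
    unfolding compact_def by meson
  obtain t E' where "l = (t, E')" by fastforce
  have lim: "(\<lambda>i. \<theta> (r i) 0) \<longlonglongrightarrow> t" "(\<lambda>i. E (r i)) \<longlonglongrightarrow> E'"
    using tendsto_fst[OF l(3)] tendsto_snd[OF l(3)] by (simp_all add: \<open>l = (t, E')\<close> o_def)
  have E': "- \<epsilon> \<le> E'" "E' \<le> - \<delta>" using l(1) by (auto simp: \<open>l = (t, E')\<close>)
  obtain \<theta>' where \<theta>': "prufer U E' \<theta>'" "\<theta>' 0 = t"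
    using prufer_exists[OF U] by metis
  have conv: "(\<lambda>i. \<theta> (r i) x) \<longlonglongrightarrow> \<theta>' x" for x
    by (rule prufer_tendsto[where a = 0, OF U(2) \<theta>(1) \<theta>'(1) lim(2)]) (use lim(1) \<theta>'(2) in simp)
  \<comment> \<open>Each fixed \<open>x\<close> eventually lies in \<open>[- n, n]\<close>, so the
    tail bounds pass to the limit.\<close>
  have far: "\<forall>\<^sub>F i in sequentially. \<bar>x\<bar> \<le> n (r i)" for x
  proof -
    obtain N :: nat where "\<bar>x\<bar> \<le> real N" using real_arch_simple by blast
    then have "\<bar>x\<bar> \<le> n (r i)" if "i \<ge> N" for i
      using that seq_suble[OF l(2), of i] \<delta>\<^sub>0(2) by (simp add: n_def)
    then show ?thesis by (auto simp: eventually_sequentially)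
  qed
  have \<theta>'_left: "0 \<le> \<theta>' x" "\<theta>' x \<le> pi / 2" if "x \<le> - M" for x
  proof -
    have "\<forall>\<^sub>F i in sequentially. 0 \<le> \<theta> (r i) x \<and> \<theta> (r i) x \<le> pi / 2"
      using far[of x] by (rule eventually_mono) (use tails(1) that in auto)
    then have ev: "\<forall>\<^sub>F i in sequentially. 0 \<le> \<theta> (r i) x" "\<forall>\<^sub>F i in sequentially. \<theta> (r i) x \<le> pi / 2"
      by (auto elim: eventually_mono)
    show "0 \<le> \<theta>' x" "\<theta>' x \<le> pi / 2"
      using tendsto_lowerbound[OF conv ev(1)] tendsto_upperbound[OF conv ev(2)] by simp_all
  qed
  have left: "0 \<le> sin (\<theta>' x) * cos (\<theta>' x)" if "x \<le> - M" for x
    using \<theta>'_left[OF that] pi_gt_zero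
    by (intro mult_nonneg_nonneg sin_ge_zero cos_ge_zero) linarith+
  have \<theta>'_right: "K * pi - pi / 2 \<le> \<theta>' x" "\<theta>' x \<le> K * pi" if "x \<ge> M" for x
  proof -
    have "\<forall>\<^sub>F i in sequentially. K * pi - pi / 2 \<le> \<theta> (r i) x \<and> \<theta> (r i) x \<le> K * pi"
      using far[of x] by (rule eventually_mono) (use tails(2) that in auto)
    then have ev: "\<forall>\<^sub>F i in sequentially. K * pi - pi / 2 \<le> \<theta> (r i) x"
      "\<forall>\<^sub>F i in sequentially. \<theta> (r i) x \<le> K * pi"
      by (auto elim: eventually_mono)
    show "K * pi - pi / 2 \<le> \<theta>' x" "\<theta>' x \<le> K * pi"
      using tendsto_lowerbound[OF conv ev(1)] tendsto_upperbound[OF conv ev(2)] by simp_all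
  qed
  have right: "sin (\<theta>' x) * cos (\<theta>' x) \<le> 0" if "x \<ge> M" for x
  proof -
    \<comment> \<open>\<open>K * pi - \<theta>' x\<close> lies in \<open>[0, pi / 2]\<close>, and
      doubling it turns the product of sine and cosine into one sine.\<close>
    have "0 \<le> sin (2 * (K * pi - \<theta>' x))"
      using \<theta>'_right[OF that]
      by (intro sin_ge_zero) auto
    also have "2 * (K * pi - \<theta>' x) = real (2 * K) * pi - 2 * \<theta>' x"
      by simp
    also have "sin (real (2 * K) * pi - 2 * \<theta>' x) = - sin (2 * \<theta>' x)"
      by (simp only: sin_diff sin_npi cos_npi) simp
    finally show ?thesis unfolding sin_double by (simp add: mult.commute)
  qed
  have "U x - E' \<ge> \<delta> / 2" if "\<bar>x\<bar> \<ge> M" for x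
    using M(2)[OF that] E'(2) by linarith
  then have "\<exists>w. bound_state U E' w"
    using bound_state_of_prufer[OF U(1) \<theta>'(1) _ M(1) _ left right, of "\<delta> / 2"] \<delta>(1) by simp
  then show ?thesis using E' \<delta>(1) by (meson le_less_trans neg_less_0_iff_less)
qed

section \<open>Absence of bound states\<close>

text \<open>\<open>h + G * P - c * x\<close> is nondecreasing, so with \<open>P\<close> bounded
  above \<open>h\<close> grows linearly, and then \<open>P\<close> cannot stay bounded. It is meant
  for \<open>h = u\<^sup>2\<close>.\<close>

lemma no_bounded_antiderivative_of_forced_growth:
  fixes h P :: "real \<Rightarrow> real"
  assumes h: "\<And>x. x \<ge> a \<Longrightarrow> (h has_real_derivative h' x) (at x)"
    and P: "\<And>x. x \<ge> a \<Longrightarrow> (P has_real_derivative h x) (at x)"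
    and growth: "\<And>x. x \<ge> a \<Longrightarrow> h' x \<ge> c - G * h x"
    and "c > 0" "G \<ge> 0" "h a \<ge> 0" and bound: "\<And>x. x \<ge> a \<Longrightarrow> P x \<le> C"
  shows False
proof -
  have low: "h x \<ge> c * (x - a) - G * (C - P a)" if "x \<ge> a" for x
  proof -
    have "h a + G * P a - c * a \<le> h x + G * P x - c * x"
    proof (rule deriv_nonneg_mono[OF that])
      fix y assume "a \<le> y"
      then show "((\<lambda>x. h x + G * P x - c * x) has_real_derivative h' y + G * h y - c) (at y)"
        by (auto intro!: derivative_eq_intros h P)
      show "0 \<le> h' y + G * h y - c"
        using growth[OF \<open>a \<le> y\<close>] by simp
    qed
    moreover have "G * P x \<le> G * C"
      using bound[OF that] \<open>G \<ge> 0\<close> by (rule mult_left_mono)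
    ultimately show ?thesis using \<open>h a \<ge> 0\<close> by (simp add: algebra_simps)
  qed
  define X where "X = a + (1 + G * (C - P a)) / c"
  have "X \<ge> a"
    using bound[of a] \<open>c > 0\<close> \<open>G \<ge> 0\<close> by (simp add: X_def)
  have ge1: "h x \<ge> 1" if "x \<ge> X" for x
  proof -
    have "1 + G * (C - P a) \<le> c * (x - a)"
      using that \<open>c > 0\<close> by (simp add: X_def field_simps)
    then show ?thesis using low[of x] that \<open>X \<ge> a\<close> by simp
  qed
  \<comment> \<open>From \<open>X\<close> on, \<open>P\<close> has slope at least 1, so at
    \<open>Y\<close> it would reach \<open>C + 1\<close>.\<close>
  define Y where "Y = X + (C - P X) + 1"
  have "X \<le> Y" using bound[OF \<open>X \<ge> a\<close>] by (simp add: Y_def)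
  have "P X - X \<le> P Y - Y"
  proof (rule deriv_nonneg_mono[OF \<open>X \<le> Y\<close>])
    fix y assume "X \<le> y"
    then show "((\<lambda>x. P x - x) has_real_derivative h y - 1) (at y)"
      using \<open>X \<ge> a\<close> by (auto intro!: derivative_eq_intros P)
    show "0 \<le> h y - 1" using ge1[OF \<open>X \<le> y\<close>] by simp
  qed
  moreover have "P Y \<le> C" using bound \<open>X \<ge> a\<close> \<open>X \<le> Y\<close> by simp
  ultimately show False by (simp add: Y_def)
qed

text \<open>Riccati criterion: \<open>F = u u' - g u\<^sup>2\<close> satisfies \<open>F' \<ge> (u' - g u)\<^sup>2 - E u\<^sup>2\<close>, so \<open>\<bar>F\<bar>\<close> stays away from
  \<open>0\<close> at one of the two ends, and there \<open>(u\<^sup>2)' = 2 F + 2 g u\<^sup>2\<close> is incompatible with \<open>u \<in> L\<^sup>2\<close>.\<close>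

lemma riccati_no_real_bound_state:
  fixes u g U :: "real \<Rightarrow> real"
  assumes g: "\<And>x. (g has_real_derivative g' x) (at x)" "\<And>x. \<bar>g x\<bar> \<le> G"
    and riccati: "\<And>x. g' x + (g x)\<^sup>2 \<le> U x" and "E < 0"
    and u: "\<And>x. (u has_real_derivative u' x) (at x)"
      "\<And>x. (u' has_real_derivative (U x - E) * u x) (at x)"
    and int: "integrable lborel (\<lambda>x. (u x)\<^sup>2)"
  shows "u x = 0"
proof (rule ccontr)
  assume "u x \<noteq> 0"
  have "G \<ge> 0" using g(2)[of 0] by linarith
  have cont: "continuous_on UNIV (\<lambda>x. (u x)\<^sup>2)"
    using u(1) by (intro continuous_intros) (meson DERIV_isCont continuous_at_imp_continuous_on)
  obtain P where P: "\<And>x. (P has_real_derivative (u x)\<^sup>2) (at x)"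
    by (rule continuous_antiderivative[OF cont]) (rule that)
  define I where "I = integral\<^sup>L lborel (\<lambda>x. (u x)\<^sup>2)"
  have PI: "P b - P a \<le> I" if "a \<le> b" for a b
    unfolding I_def using int cont P that by (intro antiderivative_le_integral) auto
  define F where "F = (\<lambda>x. u x * u' x - g x * (u x)\<^sup>2)"
  define F' where "F' = (\<lambda>x. (u' x)\<^sup>2 + (U x - E) * (u x)\<^sup>2 - g' x * (u x)\<^sup>2 - 2 * g x * u x * u' x)"
  have F: "(F has_real_derivative F' y) (at y)" for y
    unfolding F_def F'_def
    by (auto intro!: derivative_eq_intros u g simp: power2_eq_square algebra_simps)
  have F'_ge: "F' y \<ge> - E * (u y)\<^sup>2" for y
  proof -
    have "(g' y + (g y)\<^sup>2) * (u y)\<^sup>2 \<le> U y * (u y)\<^sup>2"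
      using riccati by (intro mult_right_mono) auto
    moreover have "0 \<le> (u' y - g y * u y)\<^sup>2" by simp
    moreover have "F' y - (- E * (u y)\<^sup>2)
        = (U y * (u y)\<^sup>2 - (g' y + (g y)\<^sup>2) * (u y)\<^sup>2) + (u' y - g y * u y)\<^sup>2"
      by (simp add: F'_def power2_eq_square algebra_simps)
    ultimately show ?thesis by linarith
  qed
  have F_mono: "F a \<le> F b" if "a \<le> b" for a b
  proof (rule deriv_nonneg_mono[OF that F])
    fix y show "0 \<le> F' y"
      using F'_ge[of y] mult_nonneg_nonneg[of "- E" "(u y)\<^sup>2"] \<open>E < 0\<close> by simp
  qed
  have sq: "((\<lambda>x. (u x)\<^sup>2) has_real_derivative 2 * F y + 2 * g y * (u y)\<^sup>2) (at y)" for y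
    unfolding F_def by (auto intro!: derivative_eq_intros u simp: algebra_simps)
  have gG: "\<bar>2 * g y * (u y)\<^sup>2\<bar> \<le> 2 * G * (u y)\<^sup>2" for y
    unfolding abs_mult using g(2)[of y] by (auto intro!: mult_right_mono)
  show False
  proof (cases "F x \<ge> 0")
    case True
    \<comment> \<open>\<open>F x\<close> may be 0; since \<open>u x \<noteq> 0\<close> forces
      \<open>F' x > 0\<close>, a step to the right gives a strictly positive start.\<close>
    have "0 < - E * (u x)\<^sup>2" using \<open>E < 0\<close> \<open>u x \<noteq> 0\<close> by (simp add: mult_neg_pos)
    then have "F' x > 0" using F'_ge[of x] by linarith
    then obtain d where d: "d > 0" "\<And>h. h > 0 \<Longrightarrow> h < d \<Longrightarrow> F x < F (x + h)"
      using DERIV_pos_inc_right[OF F] by blast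
    define y where "y = x + d / 2"
    have "F y > 0" using d(2)[of "d / 2"] d(1) True by (simp add: y_def)
    show False
    proof (rule no_bounded_antiderivative_of_forced_growth)
      show "((\<lambda>x. (u x)\<^sup>2) has_real_derivative 2 * F z + 2 * g z * (u z)\<^sup>2) (at z)" for z by (rule sq)
      show "(P has_real_derivative (u z)\<^sup>2) (at z)" for z by (rule P)
      show "2 * F y - 2 * G * (u z)\<^sup>2 \<le> 2 * F z + 2 * g z * (u z)\<^sup>2" if "z \<ge> y" for z
        using F_mono[OF that] gG[of z] by linarith
      show "P z \<le> P y + I" if "z \<ge> y" for z using PI[OF that] by simp
    qed (use \<open>F y > 0\<close> \<open>G \<ge> 0\<close> in auto)
  next
    case False
    \<comment> \<open>To the left \<open>F\<close> stays at most \<open>F x < 0\<close>, so the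
      growth argument runs on the reflected functions.\<close>
    show False
    proof (rule no_bounded_antiderivative_of_forced_growth)
      show "((\<lambda>z. (u (- z))\<^sup>2) has_real_derivative - (2 * F (- z) + 2 * g (- z) * (u (- z))\<^sup>2)) (at z)" for z
        using DERIV_mirror[of "\<lambda>z. (u z)\<^sup>2" "2 * F (- z) + 2 * g (- z) * (u (- z))\<^sup>2" z] sq by simp
      show "((\<lambda>z. - P (- z)) has_real_derivative (u (- z))\<^sup>2) (at z)" for z
        using DERIV_minus[OF iffD1[OF DERIV_mirror P]] by simp
      show "- 2 * F x - 2 * G * (u (- z))\<^sup>2 \<le> - (2 * F (- z) + 2 * g (- z) * (u (- z))\<^sup>2)" if "z \<ge> - x" for z
        using F_mono[of "- z" x] gG[of "- z"] that by linarith
      show "- P (- z) \<le> - P x + I" if "z \<ge> - x" for z using PI[of "- z" x] that by simp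
    qed (use False \<open>G \<ge> 0\<close> in auto)
  qed
qed

text \<open>The equation has real coefficients, so real and imaginary parts solve it separately;
  \<open>L\<close> stands for either.\<close>

lemma riccati_no_bound_state:
  fixes g U :: "real \<Rightarrow> real"
  assumes "\<And>x. (g has_real_derivative g' x) (at x)" "\<And>x. \<bar>g x\<bar> \<le> G"
    and "\<And>x. g' x + (g x)\<^sup>2 \<le> U x" and "E < 0"
  shows "\<not> bound_state U E w"
proof
  assume "bound_state U E w"
  then obtain w' w'' where nz: "\<exists>x. w x \<noteq> 0" and int: "integrable lborel (\<lambda>x. (norm (w x))\<^sup>2)"
    and w: "\<And>x. (w has_vector_derivative w' x) (at x)" "\<And>x. (w' has_vector_derivative w'' x) (at x)"
    and eq: "\<And>x. - w'' x + of_real (U x) * w x = of_real E * w x"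
    unfolding bound_state_def by blast
  have w'': "w'' x = of_real (U x - E) * w x" for x
    using eq[of x] by (simp add: algebra_simps)
  have zero: "L (w x) = 0" if L: "bounded_linear L" "\<And>z. \<bar>L z\<bar> \<le> norm z"
    "\<And>r z. L (of_real r * z) = r * L z" for L :: "complex \<Rightarrow> real" and x
  proof (rule riccati_no_real_bound_state[where u = "\<lambda>x. L (w x)" and u' = "\<lambda>x. L (w' x)",
        OF assms(1-3) \<open>E < 0\<close>])
    show d: "((\<lambda>x. L (w x)) has_real_derivative L (w' x)) (at x)" for x
      using bounded_linear.has_vector_derivative[OF L(1) w(1)]
      by (simp add: has_real_derivative_iff_has_vector_derivative)
    show "((\<lambda>x. L (w' x)) has_real_derivative (U x - E) * L (w x)) (at x)" for x
      using bounded_linear.has_vector_derivative[OF L(1) w(2)[of x]]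
      unfolding w'' L(3) by (simp add: has_real_derivative_iff_has_vector_derivative)
    have "continuous_on UNIV (\<lambda>x. L (w x))"
      using d by (meson DERIV_isCont continuous_at_imp_continuous_on)
    then have "(\<lambda>x. (L (w x))\<^sup>2) \<in> borel_measurable lborel"
      by (auto intro!: borel_measurable_continuous_onI continuous_intros)
    then show "integrable lborel (\<lambda>x. (L (w x))\<^sup>2)"
      using int L(2) by (elim Bochner_Integration.integrable_bound)
        (auto intro!: always_eventually simp flip: abs_le_square_iff)
  qed
  have "Re (w x) = 0" "Im (w x) = 0" for x
    by (rule zero; simp add: bounded_linear_Re bounded_linear_Im abs_Re_le_cmod abs_Im_le_cmod)+
  with nz show False by (simp add: complex_eq_iff)
qed

section \<open>The extremal Reissner-Nordstrom potential\<close>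

context
  fixes \<rho> :: "real \<Rightarrow> real"
  assumes rho: "rho_coordinate \<rho>"
begin

lemma rho_strict_mono:
  assumes "1 < a" "a < b"
  shows "\<rho> a < \<rho> b"
proof (rule DERIV_pos_imp_increasing[OF assms(2)])
  fix r assume "a \<le> r"
  then show "\<exists>d. (\<rho> has_real_derivative d) (at r) \<and> 0 < d"
    using rho assms(1) by (intro exI[of _ "r\<^sup>2 / (r - 1)\<^sup>2"]) (simp add: rho_coordinate_def)
qed

lemma radius_gt_1: "radius \<rho> x > 1"
  unfolding radius_def using bij_betw_inv_into[OF rho_coordinate_bij[OF rho]]
  by (auto simp: bij_betw_def)

lemma rho_radius: "\<rho> (radius \<rho> x) = x"
  unfolding radius_def using bij_betw_inv_into_right[OF rho_coordinate_bij[OF rho]] by simp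

lemma radius_rho: "r > 1 \<Longrightarrow> radius \<rho> (\<rho> r) = r"
  unfolding radius_def using bij_betw_inv_into_left[OF rho_coordinate_bij[OF rho]] by simp

lemma radius_le: "r > 1 \<Longrightarrow> x \<le> \<rho> r \<Longrightarrow> radius \<rho> x \<le> r"
  using rho_strict_mono[of r "radius \<rho> x"] rho_radius[of x] by (cases "radius \<rho> x \<le> r") auto

lemma radius_ge: "r > 1 \<Longrightarrow> \<rho> r \<le> x \<Longrightarrow> r \<le> radius \<rho> x"
  using rho_strict_mono[of "radius \<rho> x" r] rho_radius[of x] radius_gt_1[of x]
  by (cases "r \<le> radius \<rho> x") auto

lemma isCont_radius: "isCont (radius \<rho>) x"
proof -
  have "isCont (radius \<rho>) (\<rho> (radius \<rho> x))"
  \<comment> \<open>Half the distance to 1 keeps the neighbourhood inside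
    \<open>r > 1\<close>.\<close>
  proof (rule isCont_inverse_function[where f = \<rho> and d = "(radius \<rho> x - 1) / 2"])
    fix z assume z: "\<bar>z - radius \<rho> x\<bar> \<le> (radius \<rho> x - 1) / 2"
    then have "z > 1"
      using abs_le_D2[OF z] radius_gt_1[of x] by (simp add: field_simps)
    then show "radius \<rho> (\<rho> z) = z" "isCont \<rho> z"
      using radius_rho rho by (auto simp: rho_coordinate_def intro: DERIV_isCont)
  qed (use radius_gt_1[of x] in simp)
  then show ?thesis by (simp add: rho_radius)
qed

lemma DERIV_radius: "(radius \<rho> has_real_derivative (1 - 1 / radius \<rho> x)\<^sup>2) (at x)"
proof -
  define r where "r = radius \<rho> x"
  have "r > 1" unfolding r_def by (rule radius_gt_1)
  have "(radius \<rho> has_real_derivative inverse (r\<^sup>2 / (r - 1)\<^sup>2)) (at x)"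
    by (rule DERIV_inverse_function[of \<rho> _ _ _ "x - 1" "x + 1"])
       (use rho \<open>r > 1\<close> rho_radius isCont_radius in \<open>auto simp: rho_coordinate_def r_def\<close>)
  also have "inverse (r\<^sup>2 / (r - 1)\<^sup>2) = (1 - 1 / r)\<^sup>2"
    using \<open>r > 1\<close> by (simp add: divide_simps power2_eq_square) 
  finally show ?thesis by (simp add: r_def)
qed

section \<open>Bounds and tails of the potential\<close>

lemma V_eq: "V \<alpha> \<rho> x = (1 - 1 / radius \<rho> x)\<^sup>2 * (\<alpha>\<^sup>2 - (1 / radius \<rho> x)\<^sup>2)"
  by (simp add: V_def Let_def power_divide)

lemma redshift_bounds: "0 \<le> 1 - 1 / radius \<rho> x" "(1 - 1 / radius \<rho> x)\<^sup>2 \<le> 1"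
  using radius_gt_1[of x] by (simp_all add: power_le_one)

lemma continuous_on_V: "continuous_on UNIV (V \<alpha> \<rho>)"
proof -
  have "continuous_on UNIV (radius \<rho>)"
    by (intro continuous_at_imp_continuous_on ballI isCont_radius)
  moreover have "radius \<rho> x \<noteq> 0" for x using radius_gt_1[of x] by simp
  ultimately show ?thesis
    unfolding V_def[abs_def] Let_def by (intro continuous_intros) auto
qed

lemma V_bounded: "\<bar>V \<alpha> \<rho> x\<bar> \<le> \<alpha>\<^sup>2 + 1"
proof -
  have "(1 / radius \<rho> x)\<^sup>2 \<le> 1"
    using radius_gt_1[of x] by (intro power_le_one) auto
  then have "\<bar>\<alpha>\<^sup>2 - (1 / radius \<rho> x)\<^sup>2\<bar> \<le> \<alpha>\<^sup>2 + 1"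
    using zero_le_power2[of \<alpha>] zero_le_power2[of "1 / radius \<rho> x"] by linarith
  then have "(1 - 1 / radius \<rho> x)\<^sup>2 * \<bar>\<alpha>\<^sup>2 - (1 / radius \<rho> x)\<^sup>2\<bar> \<le> 1 * (\<alpha>\<^sup>2 + 1)"
    using redshift_bounds[of x] by (intro mult_mono) auto
  then show ?thesis by (simp add: V_eq abs_mult)
qed

text \<open>The negative term of \<open>V\<close> is a product of
  \<open>(1 - 1 / r)\<^sup>2\<close>, which vanishes at the horizon, and
  \<open>1 / r\<^sup>2\<close>, which vanishes at infinity.\<close>

lemma V_almost_nonneg_at_ends:
  assumes "\<eta> > 0"
  shows "\<exists>M>0. \<forall>x. \<bar>x\<bar> \<ge> M \<longrightarrow> V \<alpha> \<rho> x \<ge> - \<eta>"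
\<comment> \<open>\<open>r \<ge> 1 + 1 / \<eta>\<close> makes \<open>1 / r \<le> \<eta>\<close>, and
  \<open>r \<le> 1 + \<eta>\<close> makes \<open>1 - 1 / r \<le> \<eta>\<close>; the final 1 keeps
  the threshold positive.\<close>
proof (intro exI[of _ "\<bar>\<rho> (1 + 1 / \<eta>)\<bar> + \<bar>\<rho> (1 + \<eta>)\<bar> + 1"] conjI allI impI)
  fix x assume x: "\<bar>x\<bar> \<ge> \<bar>\<rho> (1 + 1 / \<eta>)\<bar> + \<bar>\<rho> (1 + \<eta>)\<bar> + 1"
  define r where "r = radius \<rho> x"
  have "r > 1" unfolding r_def by (rule radius_gt_1)
  define s t where "s = (1 - 1 / r)\<^sup>2" and "t = (1 / r)\<^sup>2"
  have s: "0 \<le> s" "s \<le> 1" "s \<le> 1 - 1 / r" and t: "0 \<le> t" "t \<le> 1" "t \<le> 1 / r"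
    using \<open>r > 1\<close> power_decreasing[of 1 2 "1 - 1 / r"] power_decreasing[of 1 2 "1 / r"]
    unfolding s_def t_def by (auto intro!: power_le_one)
  have V: "V \<alpha> \<rho> x = s * \<alpha>\<^sup>2 - s * t"
    by (simp add: V_eq s_def t_def r_def algebra_simps)
  have "s * t \<le> \<eta>"
  proof (cases "x \<ge> 0")
    case True
    then have "1 + 1 / \<eta> \<le> r"
      unfolding r_def using x \<open>\<eta> > 0\<close> by (intro radius_ge) auto
    then have "1 / r \<le> 1 / (1 / \<eta>)"
      using \<open>\<eta> > 0\<close> \<open>r > 1\<close> by (intro divide_left_mono) auto
    moreover have "s * t \<le> 1 * t" using s t by (intro mult_right_mono) auto
    ultimately show ?thesis using t by simp
  next
    case False
    then have "r \<le> 1 + \<eta>"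
      unfolding r_def using x \<open>\<eta> > 0\<close> by (intro radius_le) auto
    moreover have "1 - 1 / r \<le> r - 1"
    proof -
      have "0 \<le> (r - 1)\<^sup>2 / r" using \<open>r > 1\<close> by simp
      also have "\<dots> = (r - 1) - (1 - 1 / r)"
        using \<open>r > 1\<close> by (simp add: field_simps power2_eq_square)
      finally show ?thesis by simp
    qed
    moreover have "s * t \<le> s * 1" using s t by (intro mult_left_mono) auto
    ultimately show ?thesis using s by simp
  qed
  moreover have "0 \<le> s * \<alpha>\<^sup>2" using s by simp
  ultimately show "V \<alpha> \<rho> x \<ge> - \<eta>" unfolding V by linarith
qed (use abs_ge_zero in \<open>smt (verit)\<close>)

text \<open>At the horizon the pole \<open>- 1 / (r - 1)\<close> dominates \<open>\<rho>\<close>, so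
  \<open>(1 - 1 / r) * \<rho> r\<close> tends to -1 and
  \<open>V \<alpha> \<rho> x * x\<^sup>2\<close> to \<open>\<alpha>\<^sup>2 - 1\<close>.\<close>

lemma V_inverse_square_tail:
  assumes "\<alpha>\<^sup>2 - 1 < - c"
  obtains M where "\<And>x. x \<le> - M \<Longrightarrow> V \<alpha> \<rho> x \<le> - c / x\<^sup>2"
proof -
  obtain k where k: "\<And>r. r > 1 \<Longrightarrow> \<rho> r = r + 2 * ln (r - 1) - 1 / (r - 1) + 0 + k"
    using rho_coordinate_unique[OF rho rho_coordinate_explicit[of 0]] by blast
  have "((\<lambda>r::real. (1 - 1 / r) * (r + 2 * ln (r - 1) - 1 / (r - 1) + 0 + k)) \<longlongrightarrow> - 1) (at_right 1)"
    by real_asymp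
  then have "((\<lambda>r::real. ((1 - 1 / r) * (r + 2 * ln (r - 1) - 1 / (r - 1) + 0 + k))\<^sup>2 * (\<alpha>\<^sup>2 - (1 / r)\<^sup>2))
      \<longlongrightarrow> (- 1)\<^sup>2 * (\<alpha>\<^sup>2 - (1 / 1)\<^sup>2)) (at_right 1)"
    by (intro tendsto_intros) auto
  then have "\<forall>\<^sub>F r in at_right 1.
      ((1 - 1 / r) * (r + 2 * ln (r - 1) - 1 / (r - 1) + 0 + k))\<^sup>2 * (\<alpha>\<^sup>2 - (1 / r)\<^sup>2) < - c"
    by (rule order_tendstoD(2)) (use assms in simp)
  then obtain b where b: "b > 1" "\<And>r. r > 1 \<Longrightarrow> r < b \<Longrightarrow>
      ((1 - 1 / r) * (r + 2 * ln (r - 1) - 1 / (r - 1) + 0 + k))\<^sup>2 * (\<alpha>\<^sup>2 - (1 / r)\<^sup>2) < - c"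
    unfolding eventually_at_right_field by blast
  define r0 where "r0 = (1 + b) / 2"
  have r0: "r0 > 1" "r0 < b" using b(1) by (auto simp: r0_def)
  show ?thesis
  proof (rule that[of "max 1 (- \<rho> r0)"])
    \<comment> \<open>The entry 1 keeps \<open>x\<close> away from 0; the entry
      \<open>- \<rho> r0\<close> puts the radius inside \<open>(1, b)\<close>.\<close>
    fix x assume x: "x \<le> - max 1 (- \<rho> r0)"
    define r where "r = radius \<rho> x"
    have "r > 1" unfolding r_def by (rule radius_gt_1)
    have "r \<le> r0" unfolding r_def using x r0 by (intro radius_le) auto
    have "r + 2 * ln (r - 1) - 1 / (r - 1) + 0 + k = x"
      using k[OF \<open>r > 1\<close>] rho_radius[of x] by (simp add: r_def)
    then have "((1 - 1 / r) * x)\<^sup>2 * (\<alpha>\<^sup>2 - (1 / r)\<^sup>2) < - c"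
      using b(2)[OF \<open>r > 1\<close>] \<open>r \<le> r0\<close> r0 by simp
    then have "V \<alpha> \<rho> x * x\<^sup>2 \<le> - c"
      by (simp add: V_eq r_def power_mult_distrib mult_ac)
    moreover have "x\<^sup>2 > 0" using x by auto
    ultimately show "V \<alpha> \<rho> x \<le> - c / x\<^sup>2"
      by (subst pos_le_divide_eq) auto
  qed
qed

text \<open>The choice \<open>g = - (1 - 1 / r) / 2\<close> behaves like \<open>1 / (2 \<rho>)\<close> near the horizon, the only leading
  coefficient compatible with the critical strength \<open>- 1 / 4\<close>.\<close>

lemma V_no_negative_bound_state:
  assumes "\<alpha>\<^sup>2 \<ge> 3 / 4" "E < 0"
  shows "\<not> bound_state (V \<alpha> \<rho>) E w"
proof (rule riccati_no_bound_state[OF _ _ _ \<open>E < 0\<close>])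
  fix x
  define r where "r = radius \<rho> x"
  have "r > 1" unfolding r_def by (rule radius_gt_1)
  show "((\<lambda>x. - (1 - 1 / radius \<rho> x) / 2) has_real_derivative
      - ((1 - 1 / radius \<rho> x)\<^sup>2 * (1 / radius \<rho> x)\<^sup>2) / 2) (at x)"
    using \<open>r > 1\<close>
    by (auto intro!: derivative_eq_intros DERIV_radius simp: r_def power2_eq_square)
  show "\<bar>- (1 - 1 / radius \<rho> x) / 2\<bar> \<le> 1 / 2"
    using \<open>r > 1\<close> by (simp add: r_def[symmetric])
  have "(1 / r)\<^sup>2 \<le> 1" using \<open>r > 1\<close> by (intro power_le_one) auto
  \<comment> \<open>With \<open>t = (1 / r)\<^sup>2\<close>, the inequality needed is
    \<open>t / 2 \<le> \<alpha>\<^sup>2 - 1 / 4\<close>. At \<open>\<alpha>\<^sup>2 = 3 / 4\<close>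
    it reads \<open>t \<le> 1\<close>, sharp only in the limit at the horizon.\<close>
  then have "(1 - 1 / r)\<^sup>2 * (1 / 4 - (1 / r)\<^sup>2 / 2) \<le> (1 - 1 / r)\<^sup>2 * (\<alpha>\<^sup>2 - (1 / r)\<^sup>2)"
    using assms(1) by (intro mult_left_mono) auto
  then show "- ((1 - 1 / radius \<rho> x)\<^sup>2 * (1 / radius \<rho> x)\<^sup>2) / 2 + (- (1 - 1 / radius \<rho> x) / 2)\<^sup>2 \<le> V \<alpha> \<rho> x"
    unfolding V_eq r_def[symmetric] power_divide power2_minus by (simp add: algebra_simps)
qed

lemma V_bound_state_near_zero:
  assumes "\<alpha>\<^sup>2 < 3 / 4" "\<epsilon> > 0"
  shows "\<exists>E w. - \<epsilon> \<le> E \<and> E < 0 \<and> bound_state (V \<alpha> \<rho>) E w"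
proof -
  \<comment> \<open>\<open>c\<close> is the midpoint of \<open>1 / 4\<close> and
    \<open>1 - \<alpha>\<^sup>2\<close>.\<close>
  define c where "c = (5 / 4 - \<alpha>\<^sup>2) / 2"
  have c: "c > 1 / 4" "\<alpha>\<^sup>2 - 1 < - c" using assms(1) by (auto simp: c_def field_simps)
  obtain M where "\<And>x. x \<le> - M \<Longrightarrow> V \<alpha> \<rho> x \<le> - c / x\<^sup>2"
    using V_inverse_square_tail[OF c(2)] by blast
  then show ?thesis
    using bound_state_near_zero[OF continuous_on_V V_bounded V_almost_nonneg_at_ends c(1) _ assms(2)]
    by blast
qed

end

section \<open>The threshold \<open>sqrt 3 / 2\<close>\<close>

theorem mainTheorem3:
  fixes \<alpha> :: real and \<rho> :: "real \<Rightarrow> real"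
  assumes "\<alpha> \<ge> 0" and "rho_coordinate \<rho>"
  shows "(\<alpha> < sqrt 3 / 2 \<longrightarrow>
            infinite (unstable_eigenvalues \<alpha> \<rho>) \<and> 0 islimpt unstable_eigenvalues \<alpha> \<rho>) \<and>
         (\<alpha> \<ge> sqrt 3 / 2 \<longrightarrow> \<not> (\<exists>E w. E < 0 \<and> bound_state (V \<alpha> \<rho>) E w)) \<and>
         (stable \<alpha> \<rho> \<longleftrightarrow> \<alpha> \<ge> sqrt 3 / 2)"
proof -
  have sq: "(sqrt 3 / 2)\<^sup>2 = (3 / 4 :: real)" by (simp add: power_divide)
  have unstable: "infinite (unstable_eigenvalues \<alpha> \<rho>) \<and> 0 islimpt unstable_eigenvalues \<alpha> \<rho>"
    if "\<alpha> < sqrt 3 / 2"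
  proof -
    have "\<alpha>\<^sup>2 < 3 / 4"
      using power_strict_mono[OF that assms(1), of 2] by (simp add: sq)
    have "0 islimpt unstable_eigenvalues \<alpha> \<rho>"
      unfolding islimpt_approachable
    proof (intro allI impI)
      fix e :: real assume "e > 0"
      then obtain E w where "- (e / 2) \<le> E" "E < 0" "bound_state (V \<alpha> \<rho>) E w"
        using V_bound_state_near_zero[OF assms(2) \<open>\<alpha>\<^sup>2 < 3 / 4\<close>, of "e / 2"] by auto
      then show "\<exists>E\<in>unstable_eigenvalues \<alpha> \<rho>. E \<noteq> 0 \<and> dist E 0 < e"
        using \<open>e > 0\<close> by (intro bexI[of _ E]) (auto simp: unstable_eigenvalues_def)
    qed
    \<comment> \<open>Infinitude follows from accumulation, since a finite set has no limit
      point.\<close>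
    then show ?thesis using islimpt_finite by blast
  qed
  have stable: "\<not> (\<exists>E w. E < 0 \<and> bound_state (V \<alpha> \<rho>) E w)" if "\<alpha> \<ge> sqrt 3 / 2"
  proof -
    have "\<alpha>\<^sup>2 \<ge> 3 / 4"
      using power_mono[OF that, of 2] by (simp add: sq)
    then show ?thesis using V_no_negative_bound_state[OF assms(2)] by blast
  qed
  have "stable \<alpha> \<rho> \<longleftrightarrow> \<alpha> \<ge> sqrt 3 / 2"
  proof
    assume *: "stable \<alpha> \<rho>"
    have "unstable_eigenvalues \<alpha> \<rho> = {}"
      using * by (auto simp: stable_def unstable_eigenvalues_def)
    then show "\<alpha> \<ge> sqrt 3 / 2" using unstable by (cases "\<alpha> < sqrt 3 / 2") auto
  qed (use stable in \<open>auto simp: stable_def\<close>)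
  with unstable stable show ?thesis by blast
qed

end
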